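(* Let $n\ge 1$ and let $M_n=X_1+\dots+X_n$ be a martingale with respect to a filtration $\mathcal F_0\subset\mathcal F_1\subset\dots\subset\mathcal F_n$ (with $M_0=X_0=0$), whose differences satisfy $X_k\le 1$ almost surely for $k=1,\dots,n$. Let $s_k^2$, $g_k$, $c_k$ be the conditional variance, skewness and kurtosis of $X_k$ given $\mathcal F_{k-1}$, and assume that almost surely $$s_k^2\le\sigma_k^2,\qquad g_k\ge\gamma_k,\qquad c_k\le\varkappa_k,\qquad k=1,2,\dots,n,$$ with some non-random $0\le\sigma_k^2\le\infty$, $\gamma_k\ge-\infty$ and $1\le\varkappa_k\le\infty$. Let $$u(x)=\sqrt{1+\frac{x^2}{4}}-\frac x2,\qquad v(t)=\tfrac12\Bigl(t+1+\sqrt{(t+1)^2-4}\Bigr)\quad(t\ge1),$$ and assume that the (finite, non-random) numbers $\alpha_1^2,\dots,\alpha_n^2$ satisfy $$\alpha_k^2\ge\min\{\sigma_k^2,\;u^2(\gamma_k),\;v(\varkappa_k)\},\qquad k=1,\dots,n.$$ Put $$\sigma^2=\frac{\alpha_1^2+\dots+\alpha_n^2}{n},$$ and let $T_n$ be a sum of $n$ independent copies of the Bernoulli random variable $\varepsilon(\sigma^2)$. Then for every $x\in\mathbb R$ $$\mathbb P\{M_n\ge x\}\le\inf_{h>0}e^{-hx}\,\mathbb E\,e^{hT_n}\qquad\text{and}\qquad \mathbb P\{M_n\ge x\}\le\inf_{h<x}(x-h)^{-2}\,\mathbb E\,(T_n-h)_+^2 .$$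
   Context: For a martingale $M_k=X_1+\dots+X_k$ ($0\le k\le n$), with each $M_k$ being $\mathcal F_k$-measurable, the conditional variance, skewness and kurtosis of the difference $X_k$ are the $\mathcal F_{k-1}$-measurable random variables $$s_k^2=\mathbb E(X_k^2\mid\mathcal F_{k-1}),\qquad g_k=\mathbb E(X_k^3\mid\mathcal F_{k-1})/s_k^3,\qquad c_k=\mathbb E(X_k^4\mid\mathcal F_{k-1})/s_k^4,$$ where $s_k\ge0$, it is understood that $s_k^2<\infty$ almost surely, and by convention $g_k=+\infty$ and $c_k=1$ where $s_k=0$. (Since $X_k\le1$, $g_k$ is well defined with values in $[-\infty,\infty]$, and $c_k\in[1,\infty]$.) The values $\sigma_k^2=\infty$, $\gamma_k=-\infty$, $\varkappa_k=\infty$ are allowed and mean that no information on the corresponding quantity is assumed; conventions: $u(-\infty)=\infty$, $u(+\infty)=0$, $v(\infty)=\infty$. For $\sigma^2\ge0$, the Bernoulli random variable $\varepsilon=\varepsilon(\sigma^2)$ is the random variable with $\mathbb P\{\varepsilon=-\sigma^2\}=q$ and $\mathbb P\{\varepsilon=1\}=p$, where $q=\frac1{1+\sigma^2}$, $p=1-q=\frac{\sigma^2}{1+\sigma^2}$; it satisfies $\mathbb E\varepsilon=0$, $\mathbb E\varepsilon^2=\sigma^2$. Notation: $(t)_+^2=(\max\{0,t\})^2$. *)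

theory Defs
  imports "HOL-Probability.Probability"
begin

definition filtration_upto :: "'a measure \<Rightarrow> nat \<Rightarrow> (nat \<Rightarrow> 'a measure) \<Rightarrow> bool" where
  "filtration_upto M n F \<longleftrightarrow>
     (\<forall>k\<le>n. subalgebra M (F k)) \<and> (\<forall>j k. j \<le> k \<longrightarrow> k \<le> n \<longrightarrow> subalgebra (F k) (F j))"

definition martingale_upto ::
    "'a measure \<Rightarrow> nat \<Rightarrow> (nat \<Rightarrow> 'a measure) \<Rightarrow> (nat \<Rightarrow> 'a \<Rightarrow> real) \<Rightarrow> bool" where
  "martingale_upto M n F S \<longleftrightarrow>
     filtration_upto M n F \<and>
     (\<forall>k\<le>n. S k \<in> borel_measurable (F k) \<and> integrable M (S k)) \<and>
     (\<forall>j k. j \<le> k \<longrightarrow> k \<le> n \<longrightarrow> (AE \<omega> in M. real_cond_exp M (F j) (S k) \<omega> = S j \<omega>))"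

text \<open>The moments of order two to four need not be finite, so the conditional ones are taken from
  \<^const>\<open>nn_cond_exp\<close>, not from \<^const>\<open>real_cond_exp\<close>.\<close>

definition cond_variance :: "'a measure \<Rightarrow> 'a measure \<Rightarrow> ('a \<Rightarrow> real) \<Rightarrow> 'a \<Rightarrow> ereal" where
  "cond_variance M G X \<omega> = enn2ereal (nn_cond_exp M G (\<lambda>\<omega>. ennreal ((X \<omega>)^2)) \<omega>)"

text \<open>As \<^const>\<open>ennreal\<close> sends negative numbers to 0, this is the conditional expectation of the
  positive part minus that of the negative part. It is a meaningful difference when \<open>X\<close> is
  bounded above, because the first term is then finite almost surely.\<close>

definition cond_third_moment :: "'a measure \<Rightarrow> 'a measure \<Rightarrow> ('a \<Rightarrow> real) \<Rightarrow> 'a \<Rightarrow> ereal" where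
  "cond_third_moment M G X \<omega> =
     enn2ereal (nn_cond_exp M G (\<lambda>\<omega>. ennreal ((X \<omega>)^3)) \<omega>) -
     enn2ereal (nn_cond_exp M G (\<lambda>\<omega>. ennreal (- ((X \<omega>)^3))) \<omega>)"

definition cond_fourth_moment :: "'a measure \<Rightarrow> 'a measure \<Rightarrow> ('a \<Rightarrow> real) \<Rightarrow> 'a \<Rightarrow> ereal" where
  "cond_fourth_moment M G X \<omega> = enn2ereal (nn_cond_exp M G (\<lambda>\<omega>. ennreal ((X \<omega>)^4)) \<omega>)"

text \<open>Only meaningful where the conditional variance is finite.\<close>

definition cond_sd :: "'a measure \<Rightarrow> 'a measure \<Rightarrow> ('a \<Rightarrow> real) \<Rightarrow> 'a \<Rightarrow> real" where
  "cond_sd M G X \<omega> = sqrt (real_of_ereal (cond_variance M G X \<omega>))"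

definition cond_skewness :: "'a measure \<Rightarrow> 'a measure \<Rightarrow> ('a \<Rightarrow> real) \<Rightarrow> 'a \<Rightarrow> ereal" where
  "cond_skewness M G X \<omega> =
     (if cond_sd M G X \<omega> = 0 then \<infinity>
      else cond_third_moment M G X \<omega> / ereal (cond_sd M G X \<omega> ^ 3))"

definition cond_kurtosis :: "'a measure \<Rightarrow> 'a measure \<Rightarrow> ('a \<Rightarrow> real) \<Rightarrow> 'a \<Rightarrow> ereal" where
  "cond_kurtosis M G X \<omega> =
     (if cond_sd M G X \<omega> = 0 then 1
      else cond_fourth_moment M G X \<omega> / ereal (cond_sd M G X \<omega> ^ 4))"

fun skew_bound :: "ereal \<Rightarrow> ereal" where
  "skew_bound (ereal x) = ereal (sqrt (1 + x^2 / 4) - x / 2)"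
| "skew_bound PInfty = 0"
| "skew_bound MInfty = \<infinity>"

text \<open>The intended domain is \<open>1 \<le> t\<close>; the value at \<open>-\<infinity>\<close> is arbitrary.\<close>

fun kurt_bound :: "ereal \<Rightarrow> ereal" where
  "kurt_bound (ereal t) = ereal ((t + 1 + sqrt ((t + 1)^2 - 4)) / 2)"
| "kurt_bound PInfty = \<infinity>"
| "kurt_bound MInfty = 0"

text \<open>\<open>Y\<close> is a copy, on the probability space \<open>N\<close>, of the two-point variable
  with mean 0 and variance \<open>s2\<close>.\<close>

definition bernoulli_var :: "'b measure \<Rightarrow> real \<Rightarrow> ('b \<Rightarrow> real) \<Rightarrow> bool" where
  "bernoulli_var N s2 Y \<longleftrightarrow>
     Y \<in> borel_measurable N \<and>
     \<P>(\<omega> in N. Y \<omega> = - s2) = 1 / (1 + s2) \<and>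
     \<P>(\<omega> in N. Y \<omega> = 1) = s2 / (1 + s2)"

end

theory Submission
  imports Defs
begin

text \<open>All three conditions reduce to a bound on the conditional variance \<open>s\<^sup>2\<close>. Integrating
  \<open>(1 - x) (x + s\<^sup>2)\<^sup>2 \<ge> 0\<close> gives \<open>E X^3 \<le> s\<^sup>2 - s^4\<close>, that is \<open>s\<^sup>2 \<le> u\<^sup>2(g)\<close>; integrating
  \<open>(1 - x) (2 s\<^sup>2 - 1 - x) (x + s\<^sup>2)\<^sup>2 \<ge> 0\<close>, valid when \<open>s\<^sup>2 \<ge> 1\<close>, gives \<open>s\<^sup>2 \<le> v(c)\<close>. Equality holds
  for the variables \<open>\<epsilon>(s\<^sup>2)\<close> in both.

  Let \<open>f \<ge> 0\<close> be convex with convex derivative. The quadratic tangent to \<open>f(t + \<cdot>)\<close> at \<open>-\<alpha>\<^sup>2\<close> and meeting it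
  at 1 lies above it on \<open>x \<le> 1\<close>, so conditioning replaces \<open>X\<^sub>k\<close> by \<open>\<epsilon>(\<alpha>\<^sub>k\<^sup>2)\<close> one step at a time. Moving two
  parameters \<open>a < b\<close> closer together with \<open>a + b\<close> fixed increases the mean of \<open>f\<close>, by the sign pattern of
  \<open>f\<close> minus an interpolating quadratic; hence all parameters may be replaced by their average \<open>\<sigma>\<^sup>2\<close>.
  Markov's inequality for \<open>e^{hx}\<close> and \<open>(x - h)\<^sub>+\<^sup>2\<close> concludes.\<close>

section \<open>Functions with convex derivative and their sign patterns\<close>

text \<open>Monotonicity of the derivative encodes convexity of \<open>f\<close>. The derivative
  itself may have kinks, so that squared positive parts belong to the class. Nonnegativity allows
  means to be taken as nonnegative integrals, without integrability conditions.\<close>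

definition convex_deriv :: "(real \<Rightarrow> real) \<Rightarrow> bool" where
  "convex_deriv f \<longleftrightarrow> (\<forall>x. 0 \<le> f x) \<and>
     (\<exists>f'. (\<forall>x. (f has_real_derivative f' x) (at x)) \<and> mono f' \<and> convex_on UNIV f')"

text \<open>The mean of \<open>f(t + \<epsilon>(a))\<close>; iterating it gives the mean for a sum of independent variables.\<close>

definition bernoulli_mean :: "real \<Rightarrow> (real \<Rightarrow> real) \<Rightarrow> real \<Rightarrow> real" where
  "bernoulli_mean a f t = (f (t - a) + a * f (t + 1)) / (1 + a)"

lemma convex_between_zeros:
  fixes \<phi> :: "real \<Rightarrow> real"
  assumes "convex_on UNIV \<phi>" "a < b" "\<phi> a = 0" "\<phi> b = 0" "a \<le> x" "x \<le> b"
  shows "\<phi> x \<le> 0"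
proof -
  define t where "t = (x - a) / (b - a)"
  have t: "0 \<le> t" "t \<le> 1" using assms by (auto simp: t_def field_simps)
  have "(1 - t) *\<^sub>R a + t *\<^sub>R b = a + t * (b - a)" by (simp add: algebra_simps)
  also have "\<dots> = x" using assms by (simp add: t_def)
  finally show ?thesis using convex_onD[OF assms(1) t, of a b] assms by simp
qed

text \<open>If \<phi> were negative at an outside point, the zero nearer to that point would be a
  proper convex combination of it and the other zero, hence \<phi> would be negative there
  too.\<close>

lemma convex_outside_zeros:
  fixes \<phi> :: "real \<Rightarrow> real"
  assumes c: "convex_on UNIV \<phi>" and ab: "a < b" "\<phi> a = 0" "\<phi> b = 0" and x: "x \<le> a \<or> b \<le> x"
  shows "0 \<le> \<phi> x"
proof (rule ccontr)
  assume n: "\<not> 0 \<le> \<phi> x"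
  have strict: "\<phi> y < 0" if "0 < t" "t \<le> 1" "y = (1 - t) * z + t * x" "\<phi> z = 0" for t y z
  proof -
    have "\<phi> y \<le> (1 - t) * \<phi> z + t * \<phi> x"
      using convex_onD[OF c, of t z x] that by simp
    also have "\<dots> < 0" using that n by (simp add: mult_pos_neg)
    finally show ?thesis .
  qed
  from x show False
  proof
    assume x: "x \<le> a"
    have "a = (1 - (b - a) / (b - x)) * b + (b - a) / (b - x) * x"
      using ab x by (simp add: divide_simps) (simp add: algebra_simps)
    from strict[OF _ _ this] ab x show False by simp
  next
    assume x: "b \<le> x"
    have "b = (1 - (b - a) / (x - a)) * a + (b - a) / (x - a) * x"
      using ab x by (simp add: divide_simps) (simp add: algebra_simps)
    from strict[OF _ _ this] ab x show False by simp
  qed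
qed

text \<open>A quadratic has an affine derivative, and subtracting an affine function preserves
  convexity. This is what makes quadratics suitable comparison functions.\<close>

lemma sub_quadratic_convex_deriv:
  fixes f f' :: "real \<Rightarrow> real"
  assumes "\<And>x. (f has_real_derivative f' x) (at x)" "convex_on UNIV f'"
  shows "((\<lambda>x. f x - (A + B * x + C * x\<^sup>2)) has_real_derivative f' x - (B + 2 * C * x)) (at x)"
    and "convex_on UNIV (\<lambda>x. f' x - (B + 2 * C * x))"
proof -
  show "((\<lambda>x. f x - (A + B * x + C * x\<^sup>2)) has_real_derivative f' x - (B + 2 * C * x)) (at x)"
    by (auto intro!: derivative_eq_intros assms(1))
  show "convex_on UNIV (\<lambda>x. f' x - (B + 2 * C * x))"
  proof (rule convex_onI)
    fix t x y :: real assume "0 < t" "t < 1"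
    then show "f' ((1 - t) *\<^sub>R x + t *\<^sub>R y) - (B + 2 * C * ((1 - t) *\<^sub>R x + t *\<^sub>R y))
        \<le> (1 - t) * (f' x - (B + 2 * C * x)) + t * (f' y - (B + 2 * C * y))"
      using convex_onD[OF assms(2), of t x y] by (simp add: algebra_simps)
  qed simp
qed

lemma deriv_zero_between:
  fixes r \<phi> :: "real \<Rightarrow> real"
  assumes "\<And>x. (r has_real_derivative \<phi> x) (at x)" "a < b" "r a = r b"
  obtains \<xi> where "a < \<xi>" "\<xi> < b" "\<phi> \<xi> = 0"
proof -
  obtain l z where z: "a < z" "z < b" "(r has_real_derivative l) (at z)" "r b - r a = (b - a) * l"
    using MVT2[OF assms(2) assms(1)] assms(1) by metis
  have "l = \<phi> z" using z(3) assms(1) DERIV_unique by blast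
  moreover have "l = 0" using z assms by simp
  ultimately show ?thesis using that z by blast
qed

lemma deriv_sign_mono:
  fixes r \<phi> :: "real \<Rightarrow> real"
  assumes "\<And>x. (r has_real_derivative \<phi> x) (at x)" "u \<le> v"
  shows "(\<And>x. u \<le> x \<Longrightarrow> x \<le> v \<Longrightarrow> 0 \<le> \<phi> x) \<Longrightarrow> r u \<le> r v"
    and "(\<And>x. u \<le> x \<Longrightarrow> x \<le> v \<Longrightarrow> \<phi> x \<le> 0) \<Longrightarrow> r v \<le> r u"
  using DERIV_nonneg_imp_nondecreasing[OF assms(2), of r]
    DERIV_nonpos_imp_nonincreasing[OF assms(2), of r] assms(1) by blast+

text \<open>A function with convex derivative minus a quadratic has at most three sign changes.\<close>

lemma tangent_sign:
  fixes r \<phi> :: "real \<Rightarrow> real"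
  assumes d: "\<And>x. (r has_real_derivative \<phi> x) (at x)" and c: "convex_on UNIV \<phi>"
    and ab: "a < b" "r a = 0" "\<phi> a = 0" "r b = 0" and x: "x \<le> b"
  shows "r x \<le> 0"
proof -
  \<comment> \<open>Rolle adds a second zero of the convex derivative \<phi>, which fixes its signs:
    \<open>r\<close> rises to 0 at \<open>a\<close>, falls until \<xi>, then rises to 0 at
    \<open>b\<close>.\<close>
  obtain \<xi> where \<xi>: "a < \<xi>" "\<xi> < b" "\<phi> \<xi> = 0"
    using deriv_zero_between[OF d ab(1)] ab by metis
  note out = convex_outside_zeros[OF c \<xi>(1) ab(3) \<xi>(3)]
  note btw = convex_between_zeros[OF c \<xi>(1) ab(3) \<xi>(3)]
  consider "x \<le> a" | "a \<le> x" "x \<le> \<xi>" | "\<xi> \<le> x" by linarith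
  then show ?thesis
  proof cases
    case 1
    then have "r x \<le> r a" by (intro deriv_sign_mono(1)[OF d] out) (use \<xi> in auto)
    then show ?thesis using ab by simp
  next
    case 2
    then have "r x \<le> r a" by (intro deriv_sign_mono(2)[OF d] btw) (use \<xi> in auto)
    then show ?thesis using ab by simp
  next
    case 3
    then have "r x \<le> r b" using x by (intro deriv_sign_mono(1)[OF d] out) (use \<xi> in auto)
    then show ?thesis using ab by simp
  qed
qed

text \<open>Rolle places one zero of \<phi> in each gap, \<xi> and \<eta>. By convexity
  \<open>r\<close> increases up to \<xi> and decreases from \<xi> to \<eta>; so it reaches 0 from
  below at \<open>z1\<close>, and between \<open>z1\<close> and \<open>z2\<close> it rises from 0
  and falls back to 0.\<close>

lemma three_zeros_sign:
  fixes r \<phi> :: "real \<Rightarrow> real"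
  assumes d: "\<And>x. (r has_real_derivative \<phi> x) (at x)" and c: "convex_on UNIV \<phi>"
    and z: "z1 < z2" "z2 < z3" "r z1 = 0" "r z2 = 0" "r z3 = 0"
  shows "x \<le> z1 \<Longrightarrow> r x \<le> 0" "z1 \<le> x \<Longrightarrow> x \<le> z2 \<Longrightarrow> 0 \<le> r x"
proof -
  obtain \<xi> where \<xi>: "z1 < \<xi>" "\<xi> < z2" "\<phi> \<xi> = 0"
    using deriv_zero_between[OF d z(1)] z by metis
  obtain \<eta> where \<eta>: "z2 < \<eta>" "\<eta> < z3" "\<phi> \<eta> = 0"
    using deriv_zero_between[OF d z(2)] z by metis
  have lt: "\<xi> < \<eta>" using \<xi> \<eta> by simp
  note out = convex_outside_zeros[OF c lt \<xi>(3) \<eta>(3)]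
  note btw = convex_between_zeros[OF c lt \<xi>(3) \<eta>(3)]
  show "r x \<le> 0" if "x \<le> z1"
  proof -
    have "r x \<le> r z1" using that
      by (intro deriv_sign_mono(1)[OF d] out) (use \<xi> in auto)
    then show ?thesis using z by simp
  qed
  show "0 \<le> r x" if x: "z1 \<le> x" "x \<le> z2"
  proof (cases "x \<le> \<xi>")
    case True
    then have "r z1 \<le> r x" using x
      by (intro deriv_sign_mono(1)[OF d] out) (use \<xi> in auto)
    then show ?thesis using z by simp
  next
    case False
    then have "r z2 \<le> r x" using x \<eta>
      by (intro deriv_sign_mono(2)[OF d] btw) (use \<xi> in auto)
    then show ?thesis using z by simp
  qed
qed

section \<open>Quadratic majorants\<close>

lemma convex_deriv_measurable:
  assumes "convex_deriv f"
  shows "f \<in> borel_measurable borel"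
proof -
  have "isCont f x" for x using assms DERIV_isCont unfolding convex_deriv_def by blast
  then show ?thesis by (intro borel_measurable_continuous_onI continuous_at_imp_continuous_on) auto
qed

lemma convex_deriv_above_tangent:
  fixes f f' :: "real \<Rightarrow> real"
  assumes "\<And>x. (f has_real_derivative f' x) (at x)" "mono f'" "a < b"
  shows "f a + f' a * (b - a) \<le> f b"
proof -
  obtain z where z: "a < z" "z < b" "f b - f a = (b - a) * f' z"
    using MVT2[OF assms(3) assms(1)] by metis
  have "(b - a) * f' a \<le> (b - a) * f' z"
    using z monoD[OF assms(2), of a z] by (intro mult_left_mono) auto
  then show ?thesis using z by (simp add: algebra_simps)
qed

text \<open>The quadratic is tangent to \<open>f\<close> at \<open>t - a\<close> and meets it at \<open>t + 1\<close>, the two atoms of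
  \<open>t + \<epsilon>(a)\<close>; its mean under \<open>\<epsilon>(a)\<close>, a variable of mean 0 and variance \<open>a\<close>, is the last equation.\<close>

lemma quadratic_majorant:
  assumes "convex_deriv f" "0 \<le> a"
  obtains A B C :: "real \<Rightarrow> real"
  where "A \<in> borel_measurable borel" "B \<in> borel_measurable borel" "C \<in> borel_measurable borel"
    "\<And>t. 0 \<le> C t" "\<And>t y. y \<le> 1 \<Longrightarrow> f (t + y) \<le> A t + B t * y + C t * y\<^sup>2"
    "\<And>t. A t + C t * a = bernoulli_mean a f t"
proof -
  obtain f' where f': "\<And>x. (f has_real_derivative f' x) (at x)" "mono f'" "convex_on UNIV f'"
    using assms by (auto simp: convex_deriv_def)
  have [measurable]: "f \<in> borel_measurable borel" using assms(1) by (rule convex_deriv_measurable)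
  have [measurable]: "f' \<in> borel_measurable borel" by (rule borel_measurable_mono[OF f'(2)])
  \<comment> \<open>These are the coefficients of
    \<open>f (t - a) + f' (t - a) * (y + a) + C t * (y + a)^2\<close> in powers of \<open>y\<close>,
    with \<open>C t\<close> chosen so that the value at \<open>y = 1\<close> is
    \<open>f (t + 1)\<close>.\<close>
  define C where "C t = (f (t + 1) - f (t - a) - f' (t - a) * (1 + a)) / (1 + a)\<^sup>2" for t
  define B where "B t = f' (t - a) + 2 * C t * a" for t
  define A where "A t = f (t - a) + f' (t - a) * a + C t * a\<^sup>2" for t
  have pos: "0 < 1 + a" using assms by simp
  have C1: "C t * (1 + a)\<^sup>2 = f (t + 1) - f (t - a) - f' (t - a) * (1 + a)" for t
    using pos by (simp add: C_def)
  \<comment> \<open>The tangent at \<open>t - a\<close> lies below the convex function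
    \<open>f\<close>. The sign matters later: it makes the mean of the quadratic increase with the
    variance.\<close>
  have C0: "0 \<le> C t" for t
    unfolding C_def using convex_deriv_above_tangent[OF f'(1,2), of "t - a" "t + 1"] assms(2)
    by (intro divide_nonneg_nonneg) (auto simp: algebra_simps)
  show thesis
  proof (rule that[of A B C])
    show [measurable]: "C \<in> borel_measurable borel" unfolding C_def by measurable
    show "A \<in> borel_measurable borel" "B \<in> borel_measurable borel"
      unfolding A_def B_def by measurable
    show "0 \<le> C t" for t by (rule C0)
    show "A t + C t * a = bernoulli_mean a f t" for t
    proof -
      have "(1 + a) * (A t + C t * a) = (1 + a) * (f (t - a) + f' (t - a) * a) + a * (C t * (1 + a)\<^sup>2)"
        by (simp add: A_def algebra_simps power2_eq_square)
      also have "\<dots> = f (t - a) + a * f (t + 1)" unfolding C1 by (simp add: algebra_simps)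
      finally show ?thesis using pos by (simp add: bernoulli_mean_def field_simps)
    qed
    show "f (t + y) \<le> A t + B t * y + C t * y\<^sup>2" if "y \<le> 1" for t y
    proof -
      \<comment> \<open>The same quadratic rewritten in the variable \<open>x = t + y\<close>, so
        that \<open>tangent_sign\<close> applies to \<open>f\<close> itself.\<close>
      define A' B' where "A' = A t - B t * t + C t * t\<^sup>2" and "B' = B t - 2 * C t * t"
      define r where "r = (\<lambda>x. f x - (A' + B' * x + C t * x\<^sup>2))"
      define \<phi> where "\<phi> = (\<lambda>x. f' x - (B' + 2 * C t * x))"
      have q: "A' + B' * (t + y) + C t * (t + y)\<^sup>2 = A t + B t * y + C t * y\<^sup>2" for y
        by (simp add: A'_def B'_def algebra_simps power2_eq_square)
      have r: "(r has_real_derivative \<phi> x) (at x)" "convex_on UNIV \<phi>" for x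
        unfolding r_def \<phi>_def using sub_quadratic_convex_deriv[OF f'(1,3)] by auto
      have "r (t - a) = 0"
        using q[of "- a"] by (simp add: r_def A_def B_def algebra_simps power2_eq_square)
      moreover have "\<phi> (t - a) = 0" by (simp add: \<phi>_def B'_def B_def algebra_simps)
      moreover have "r (t + 1) = 0"
        using q[of 1] C1[of t] by (simp add: r_def A_def B_def algebra_simps power2_eq_square)
      ultimately have "r (t + y) \<le> 0"
        using tangent_sign[OF r, of "t - a" "t + 1"] that pos by simp
      then show ?thesis using q[of y] by (simp add: r_def)
    qed
  qed
qed

section \<open>Averaging the Bernoulli parameters\<close>

lemma quadratic_interpolation:
  fixes f :: "real \<Rightarrow> real"
  assumes "z1 < z2" "z2 < z3"
  obtains A B C where "\<And>x. x \<in> {z1, z2, z3} \<Longrightarrow> f x = A + B * x + C * x\<^sup>2"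
proof -
  \<comment> \<open>Newton's divided differences: \<open>D\<close> is the one of first order at
    \<open>z1, z2\<close>, and \<open>C\<close> the one of second order at all three nodes.\<close>
  define D where "D = (f z2 - f z1) / (z2 - z1)"
  define C where "C = ((f z3 - f z1) / (z3 - z1) - D) / (z3 - z2)"
  have D: "D * (z2 - z1) = f z2 - f z1" using assms by (simp add: D_def)
  have "C * (z3 - z2) = (f z3 - f z1) / (z3 - z1) - D" using assms by (simp add: C_def)
  then have "C * (z3 - z2) * (z3 - z1) = f z3 - f z1 - D * (z3 - z1)"
    using assms by (simp add: field_simps)
  with D have "f x = (f z1 - D * z1 + C * z1 * z2) + (D - C * (z1 + z2)) * x + C * x\<^sup>2"
    if "x \<in> {z1, z2, z3}" for x
    using that by (auto simp: algebra_simps power2_eq_square)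
  then show thesis using that by blast
qed

text \<open>Both sides have the same mean for a quadratic, so \<open>f\<close> may be replaced by its difference with
  the quadratic interpolating it at the three largest atoms of the more spread pair.\<close>

lemma bernoulli_mean_smoothing:
  assumes f: "convex_deriv f" and "0 \<le> a" "a < b" "a + b = a' + b'"
    and "a \<le> a'" "a' \<le> b"
  shows "bernoulli_mean a (bernoulli_mean b f) t \<le> bernoulli_mean a' (bernoulli_mean b' f) t"
proof -
  obtain f' where f': "\<And>x. (f has_real_derivative f' x) (at x)" "mono f'" "convex_on UNIV f'"
    using assms by (auto simp: convex_deriv_def)
  have b': "b' = a + b - a'" using assms by simp
  have ge: "0 \<le> a'" "0 \<le> b'" "0 \<le> b" using assms by auto
  obtain A B C where q: "\<And>x. x \<in> {t + 1 - b, t + 1 - a, t + 2} \<Longrightarrow> f x = A + B * x + C * x\<^sup>2"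
    using quadratic_interpolation[of "t + 1 - b" "t + 1 - a" "t + 2" f] assms by auto
  define r where "r = (\<lambda>x. f x - (A + B * x + C * x\<^sup>2))"
  define \<phi> where "\<phi> = (\<lambda>x. f' x - (B + 2 * C * x))"
  have r: "(r has_real_derivative \<phi> x) (at x)" "convex_on UNIV \<phi>" for x
    unfolding r_def \<phi>_def using sub_quadratic_convex_deriv[OF f'(1,3)] by auto
  have z: "r (t + 1 - b) = 0" "r (t + 1 - a) = 0" "r (t + 2) = 0"
    by (simp_all add: r_def q)
  note sgn = three_zeros_sign[OF r _ _ z]
  \<comment> \<open>The smallest atom \<open>t - a - b\<close> is common to both pairs of
    parameters. The middle atoms of the closer pair lie between the two middle atoms of the spread
    pair, where \<open>r\<close> is nonnegative.\<close>
  have neg: "r (t - a - b) \<le> 0" by (rule sgn(1)) (use assms in auto)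
  have pos: "0 \<le> r (t + 1 - a')" "0 \<le> r (t + 1 - b')" by (rule sgn(2); use assms in auto)+
  \<comment> \<open>The product of the denominators grows by \<open>(a' - a) * (b - a')\<close>, so
    the nonpositive value of \<open>r\<close> at the smallest atom gets a smaller weight for the
    closer pair.\<close>
  have D: "0 < (1 + a) * (1 + b)" "(1 + a) * (1 + b) \<le> (1 + a') * (1 + b')"
  proof -
    have "0 \<le> (a' - a) * (b - a')" using assms by simp
    then show "(1 + a) * (1 + b) \<le> (1 + a') * (1 + b')" by (simp add: b' algebra_simps)
  qed (use assms in simp)
  have two: "bernoulli_mean c (bernoulli_mean d g) t =
      (g (t - c - d) + d * g (t + 1 - c) + c * g (t + 1 - d) + c * d * g (t + 2)) / ((1 + c) * (1 + d))"
    if "0 \<le> c" "0 \<le> d" for c d g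
  proof -
    have "1 + c \<noteq> 0" "1 + d \<noteq> 0" using that by auto
    then show ?thesis
      unfolding bernoulli_mean_def by (simp add: divide_simps) (simp add: algebra_simps)
  qed
  \<comment> \<open>A sum of independent copies of \<epsilon>(c) and \<epsilon>(d) has mean 0 and
    variance \<open>c + d\<close>, so the contribution of the quadratic depends on
    \<open>c + d\<close> alone.\<close>
  have quad: "bernoulli_mean c (bernoulli_mean d f) t =
      bernoulli_mean c (bernoulli_mean d r) t + (A + B * t + C * (t\<^sup>2 + c + d))"
    if "0 \<le> c" "0 \<le> d" for c d
  proof -
    have ne: "1 + c \<noteq> 0" "1 + d \<noteq> 0" using that by auto
    have "f = (\<lambda>x. r x + (A + B * x + C * x\<^sup>2))" by (simp add: r_def)
    then show ?thesis
      unfolding bernoulli_mean_def using ne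
      by (simp add: divide_simps) (simp add: algebra_simps power2_eq_square)
  qed
  have "bernoulli_mean a (bernoulli_mean b r) t = r (t - a - b) / ((1 + a) * (1 + b))"
    using assms ge z by (simp add: two)
  also have "\<dots> \<le> r (t - a - b) / ((1 + a') * (1 + b'))"
    using neg D divide_left_mono_neg[OF D(2) neg] ge by simp
  also have "\<dots> \<le> bernoulli_mean a' (bernoulli_mean b' r) t"
  proof -
    have e: "t - a' - b' = t - a - b" using assms by simp
    show ?thesis
      unfolding two[OF ge(1,2)] e z using pos ge by (intro divide_right_mono) auto
  qed
  finally show ?thesis
    using assms(2) ge by (simp add: quad) (simp add: assms(4) add.assoc)
qed

text \<open>The result is a combination of two shifts of \<open>f\<close> with nonnegative weights.
  Closure of the class under this operation is what allows one-step bounds to be iterated.\<close>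

lemma convex_deriv_bernoulli_mean:
  assumes "convex_deriv f" "0 \<le> a"
  shows "convex_deriv (bernoulli_mean a f)"
proof -
  obtain f' where f': "\<And>x. (f has_real_derivative f' x) (at x)" "mono f'" "convex_on UNIV f'"
    using assms by (auto simp: convex_deriv_def)
  have sh: "((\<lambda>x. f (x + c)) has_real_derivative f' (x + c)) (at x)" for x c
    using f'(1) DERIV_shift by blast
  have "(bernoulli_mean a f has_real_derivative bernoulli_mean a f' x) (at x)" for x
    unfolding bernoulli_mean_def[abs_def] using sh[of "- a"] sh[of 1]
    by (intro DERIV_cdivide DERIV_add DERIV_cmult) auto
  moreover have "mono (bernoulli_mean a f')"
    unfolding bernoulli_mean_def using assms(2) monoD[OF f'(2)]
    by (intro monoI divide_right_mono add_mono mult_left_mono) auto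
  moreover have "convex_on UNIV (bernoulli_mean a f')"
  proof (rule convex_onI)
    fix u x y :: real assume u: "0 < u" "u < 1"
    have *: "f' ((1 - u) * x + u * y + c) \<le> (1 - u) * f' (x + c) + u * f' (y + c)" for c
      using convex_onD[OF f'(3), of u "x + c" "y + c"] u by (simp add: algebra_simps)
    have "bernoulli_mean a f' ((1 - u) * x + u * y) \<le>
        ((1 - u) * f' (x + - a) + u * f' (y + - a) + a * ((1 - u) * f' (x + 1) + u * f' (y + 1))) / (1 + a)"
      unfolding bernoulli_mean_def using *[of "- a"] *[of 1] assms(2)
      by (intro divide_right_mono add_mono mult_left_mono) auto
    also have "\<dots> = (1 - u) * bernoulli_mean a f' x + u * bernoulli_mean a f' y"
      by (simp add: bernoulli_mean_def add_divide_distrib[symmetric] algebra_simps)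
    finally show "bernoulli_mean a f' ((1 - u) *\<^sub>R x + u *\<^sub>R y)
        \<le> (1 - u) * bernoulli_mean a f' x + u * bernoulli_mean a f' y" by simp
  qed simp
  moreover have "0 \<le> bernoulli_mean a f x" for x
    using assms by (simp add: bernoulli_mean_def convex_deriv_def)
  ultimately show ?thesis by (auto simp: convex_deriv_def)
qed

text \<open>The order in which independent variables are integrated out is immaterial. Hence
  iterated means are folds over a multiset of parameters, and any two parameters can be brought next
  to the test function.\<close>

interpretation bernoulli_mean: comp_fun_commute bernoulli_mean
proof
  fix a b
  show "bernoulli_mean b \<circ> bernoulli_mean a = bernoulli_mean a \<circ> bernoulli_mean b"
    by (intro ext) (simp add: bernoulli_mean_def add_divide_distrib algebra_simps)
qed

lemma bernoulli_mean_mono: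
  assumes "\<And>t. f t \<le> g t" "0 \<le> a"
  shows "bernoulli_mean a f t \<le> bernoulli_mean a g t"
  using assms unfolding bernoulli_mean_def by (intro divide_right_mono add_mono mult_left_mono) auto

lemma fold_bernoulli_mean_mono:
  assumes "\<And>t. f t \<le> g t" "\<And>a. a \<in># R \<Longrightarrow> 0 \<le> a"
  shows "fold_mset bernoulli_mean f R t \<le> fold_mset bernoulli_mean g R t"
  using assms(2)
proof (induction R arbitrary: t)
  case (add a R)
  then show ?case by (simp add: bernoulli_mean_mono)
qed (simp add: assms)

text \<open>If all entries were at most \<open>m\<close> and one of them differed from
  \<open>m\<close>, the sum would be too small; so some entry exceeds \<open>m\<close>. The same
  argument for the negated multiset gives an entry below \<open>m\<close>, which is why
  \<open>ex\<close> is stated for arbitrary \<open>A\<close> and \<open>m\<close>.\<close>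

lemma exists_straddling_pair:
  fixes m :: real
  assumes "sum_mset A = real (size A) * m" "A \<noteq> replicate_mset (size A) m"
  obtains a b R where "A = add_mset a (add_mset b R)" "a < m" "m < b"
proof -
  have not_eq: "\<exists>x\<in>#A. x \<noteq> m"
  proof (rule ccontr)
    assume "\<not> ?thesis"
    then have "set_mset A \<subseteq> {m}" by auto
    then show False using assms(2) set_mset_subset_singletonD by fastforce
  qed
  have ex: "\<exists>x\<in>#A. m < x" if s: "sum_mset A = real (size A) * m" "\<exists>x\<in>#A. x \<noteq> m" for A and m :: real
  proof (rule ccontr)
    assume "\<not> ?thesis"
    then have le: "\<And>x. x \<in># A \<Longrightarrow> x \<le> m" by auto
    obtain x B where x: "A = add_mset x B" "x \<noteq> m" using s(2) by (metis insert_DiffM)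
    have "sum_mset B \<le> real (size B) * m"
      using sum_mset_mono[of B "\<lambda>x. x" "\<lambda>_. m"] le x by simp
    moreover have "x < m" using le[of x] x by simp
    ultimately show False using s(1) x by (simp add: algebra_simps)
  qed
  obtain b where b: "b \<in># A" "m < b" using ex[OF assms(1) not_eq] by blast
  have neg: "sum_mset (image_mset uminus A) = - sum_mset A" for A :: "real multiset"
    by (induction A) auto
  have "\<exists>x\<in>#image_mset uminus A. - m < x"
    by (rule ex) (use assms(1) not_eq neg[of A] in auto)
  then obtain a where a: "a \<in># A" "a < m" by auto
  have "a \<in># A - {#b#}" using a b by (metis insert_DiffM insert_noteq_member less_asym)
  then obtain R where "A - {#b#} = add_mset a R" by (metis insert_DiffM)
  then have "A = add_mset a (add_mset b R)" using b by (metis add_mset_commute insert_DiffM)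
  then show thesis using that a b by blast
qed

text \<open>A pair \<open>a < m < b\<close> is smoothed to \<open>m\<close> and
  \<open>a + b - m\<close>, which keeps the sum. The finished entry \<open>m\<close> is absorbed
  into the test function, so the remaining multiset is smaller by one and still has average
  \<open>m\<close>; the induction therefore runs over the size with \<open>f\<close>
  arbitrary.\<close>

lemma fold_bernoulli_mean_le_replicate:
  assumes "convex_deriv f" "\<And>a. a \<in># A \<Longrightarrow> 0 \<le> a" "sum_mset A = real (size A) * m"
  shows "fold_mset bernoulli_mean f A t \<le> fold_mset bernoulli_mean f (replicate_mset (size A) m) t"
  using assms
proof (induction "size A" arbitrary: A f t)
  case 0
  then show ?case by simp
next
  case (Suc n)
  show ?case
  proof (cases "A = replicate_mset (size A) m")
    case True
    then show ?thesis by simp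
  next
    case False
    obtain a b R where A: "A = add_mset a (add_mset b R)" "a < m" "m < b"
      using exists_straddling_pair[OF Suc.prems(3) False] .
    have a: "0 \<le> a" "0 \<le> m" using Suc.prems(2)[of a] A by auto
    have n: "n = Suc (size R)" using Suc.hyps(2) A by simp
    have "fold_mset bernoulli_mean f A t = fold_mset bernoulli_mean (bernoulli_mean a (bernoulli_mean b f)) R t"
      by (simp add: A(1) bernoulli_mean.fold_mset_fun_left_comm)
    also have "\<dots> \<le> fold_mset bernoulli_mean (bernoulli_mean m (bernoulli_mean (a + b - m) f)) R t"
      using Suc.prems A a by (intro fold_bernoulli_mean_mono bernoulli_mean_smoothing) auto
    also have "\<dots> = fold_mset bernoulli_mean (bernoulli_mean m f) (add_mset (a + b - m) R) t"
      by (simp add: bernoulli_mean.fold_mset_fun_left_comm bernoulli_mean.fun_left_comm)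
    also have "\<dots> \<le> fold_mset bernoulli_mean (bernoulli_mean m f)
        (replicate_mset (size (add_mset (a + b - m) R)) m) t"
    proof (rule Suc.hyps(1))
      show "n = size (add_mset (a + b - m) R)" using n by simp
      show "convex_deriv (bernoulli_mean m f)"
        using Suc.prems a by (intro convex_deriv_bernoulli_mean) auto
      show "0 \<le> c" if "c \<in># add_mset (a + b - m) R" for c using that Suc.prems(2)[of c] A a by auto
      show "sum_mset (add_mset (a + b - m) R) = real (size (add_mset (a + b - m) R)) * m"
        using Suc.prems(3) A by (simp add: algebra_simps)
    qed
    also have "\<dots> = fold_mset bernoulli_mean f (replicate_mset (size A) m) t"
      by (simp add: A(1) bernoulli_mean.fold_mset_fun_left_comm[symmetric])
    finally show ?thesis .
  qed
qed

section \<open>The two families of test functions\<close>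

lemma convex_deriv_exp: "0 \<le> h \<Longrightarrow> convex_deriv (\<lambda>x. exp (h * x))"
  unfolding convex_deriv_def
proof (intro conjI exI[of _ "\<lambda>x. h * exp (h * x)"] allI)
  assume h: "0 \<le> h"
  show "((\<lambda>x. exp (h * x)) has_real_derivative h * exp (h * x)) (at x)" for x
    by (auto intro!: derivative_eq_intros)
  show "mono (\<lambda>x. h * exp (h * x))"
    using h by (intro monoI) (auto intro!: mult_left_mono)
  show "convex_on UNIV (\<lambda>x. h * exp (h * x))"
    by (rule convex_on_realI[where f' = "\<lambda>x. h * h * exp (h * x)"])
       (use h in \<open>auto intro!: derivative_eq_intros mult_left_mono\<close>)
qed simp

lemma convex_deriv_pos_part_square: "convex_deriv (\<lambda>x. (max 0 (x - h))\<^sup>2)"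
  unfolding convex_deriv_def
proof (intro conjI exI[of _ "\<lambda>x. 2 * max 0 (x - h)"] allI)
  show "((\<lambda>x. (max 0 (x - h))\<^sup>2) has_real_derivative 2 * max 0 (x - h)) (at x)" for x
  proof -
    consider "x < h" | "x = h" | "h < x" by linarith
    then show ?thesis
    proof cases
      case 1
      have "((\<lambda>_. 0) has_real_derivative 2 * max 0 (x - h)) (at x)" using 1 by (auto intro!: derivative_eq_intros)
      then show ?thesis
        by (rule has_field_derivative_transform_within_open[where S = "{..<h}"]) (use 1 in auto)
    next
      case 3
      have "((\<lambda>x. (x - h)\<^sup>2) has_real_derivative 2 * max 0 (x - h)) (at x)"
        using 3 by (auto intro!: derivative_eq_intros)
      then show ?thesis
        by (rule has_field_derivative_transform_within_open[where S = "{h<..}"]) (use 3 in auto)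
    next
      case 2
      \<comment> \<open>At the kink the difference quotient is bounded by the absolute value of the
        increment, so the derivative is 0 there.\<close>
      have "((\<lambda>k. (max 0 k)\<^sup>2 / k) \<longlongrightarrow> 0) (at (0::real))"
      proof (rule Lim_null_comparison)
        show "\<forall>\<^sub>F k in at 0. norm ((max 0 k)\<^sup>2 / k) \<le> \<bar>k::real\<bar>"
          by (intro always_eventually) (auto simp: max_def power2_eq_square)
        show "((\<lambda>k. \<bar>k\<bar>) \<longlongrightarrow> 0) (at (0::real))"
          by (intro tendsto_rabs_zero tendsto_ident_at)
      qed
      then show ?thesis using 2 by (simp add: DERIV_def)
    qed
  qed
  show "mono (\<lambda>x. 2 * max 0 (x - h))" by (auto intro!: monoI)
  show "convex_on UNIV (\<lambda>x. 2 * max 0 (x - h))"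
  proof (rule convex_onI)
    fix t x y :: real assume t: "0 < t" "t < 1"
    have "(1 - t) * x + t * y - h = (1 - t) * (x - h) + t * (y - h)" by (simp add: algebra_simps)
    also have "\<dots> \<le> (1 - t) * max 0 (x - h) + t * max 0 (y - h)"
      using t by (intro add_mono mult_left_mono) auto
    finally have "max 0 ((1 - t) * x + t * y - h) \<le> (1 - t) * max 0 (x - h) + t * max 0 (y - h)"
      using t by simp
    then show "2 * max 0 ((1 - t) *\<^sub>R x + t *\<^sub>R y - h) \<le>
        (1 - t) * (2 * max 0 (x - h)) + t * (2 * max 0 (y - h))"
      unfolding real_scaleR_def mult.left_commute[of _ "2::real"] distrib_left[symmetric]
      by (rule mult_left_mono) simp
  qed simp
qed simp

section \<open>Conditional expectations of quadratic bounds\<close>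

lemma ennreal_linear:
  assumes "0 \<le> z" "0 \<le> p" "0 \<le> q" "0 \<le> r" "0 \<le> s" "0 \<le> u" "0 \<le> v" "0 \<le> y"
  shows "ennreal z + ennreal p + ennreal q * ennreal u + ennreal r * ennreal v + ennreal s * ennreal y
    = ennreal (z + p + q * u + r * v + s * y)"
  using assms by (simp add: ennreal_mult)

lemma pos_neg_parts:
  obtains p n where "0 \<le> p" "0 \<le> n" "y = p - n" "ennreal y = ennreal p" "ennreal (- y) = ennreal n"
    "max 0 y = (p::real)"
  by (rule that[of "max 0 y" "max 0 (- y)"]) (auto simp: max_def ennreal_neg)

text \<open>Each coefficient and \<open>x\<close> are split into positive and negative parts, and
  every negative contribution is moved to the other side. Both sides then consist of nonnegative
  terms, whose conditional expectations always make sense.\<close>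

lemma ennreal_le_quadratic:
  fixes x a b c z w :: real
  assumes le: "max 0 z \<le> max 0 w + a + b * x + c * x\<^sup>2"
  shows "ennreal z + ennreal (- a) + ennreal (- b) * ennreal x + ennreal b * ennreal (- x)
        + ennreal (- c) * ennreal (x\<^sup>2)
      \<le> ennreal w + ennreal a + ennreal b * ennreal x + ennreal (- b) * ennreal (- x)
        + ennreal c * ennreal (x\<^sup>2)"
proof -
  obtain ap an where a: "0 \<le> ap" "0 \<le> an" "a = ap - an" "ennreal a = ennreal ap" "ennreal (- a) = ennreal an"
    by (rule pos_neg_parts)
  obtain bp bn where b: "0 \<le> bp" "0 \<le> bn" "b = bp - bn" "ennreal b = ennreal bp" "ennreal (- b) = ennreal bn"
    by (rule pos_neg_parts)
  obtain cp cn where c: "0 \<le> cp" "0 \<le> cn" "c = cp - cn" "ennreal c = ennreal cp" "ennreal (- c) = ennreal cn"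
    by (rule pos_neg_parts)
  obtain xp xn where x: "0 \<le> xp" "0 \<le> xn" "x = xp - xn" "ennreal x = ennreal xp" "ennreal (- x) = ennreal xn"
    by (rule pos_neg_parts)
  obtain zp where z: "0 \<le> zp" "ennreal z = ennreal zp" "max 0 z = zp" by (rule pos_neg_parts)
  obtain wp where w: "0 \<le> wp" "ennreal w = ennreal wp" "max 0 w = wp" by (rule pos_neg_parts)
  have bx: "b * x = bp * xp - bp * xn - bn * xp + bn * xn"
    unfolding b(3) x(3) by (simp add: algebra_simps)
  have cx: "c * x\<^sup>2 = cp * x\<^sup>2 - cn * x\<^sup>2"
    unfolding c(3) by (simp add: algebra_simps)
  have "zp + an + bn * xp + bp * xn + cn * x\<^sup>2 \<le> wp + ap + bp * xp + bn * xn + cp * x\<^sup>2"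
    using le unfolding bx cx z w a(3) by linarith
  then show ?thesis
    unfolding a(4,5) b(4,5) c(4,5) x(4,5) z w
    using a(1,2) b(1,2) c(1,2) x(1,2) z(1) w(1) by (simp only: ennreal_linear zero_le_power2 ennreal_leI)
qed

context sigma_finite_subalgebra
begin

lemma nn_cond_exp_linear:
  assumes [measurable]: "Z \<in> borel_measurable M" "U \<in> borel_measurable M" "V \<in> borel_measurable M"
      "Y \<in> borel_measurable M"
    and F: "p \<in> borel_measurable F" "q \<in> borel_measurable F" "r \<in> borel_measurable F"
      "s \<in> borel_measurable F"
  shows "AE \<omega> in M. nn_cond_exp M F (\<lambda>\<omega>. Z \<omega> + p \<omega> + q \<omega> * U \<omega> + r \<omega> * V \<omega> + s \<omega> * Y \<omega>) \<omega> =
    nn_cond_exp M F Z \<omega> + p \<omega> + q \<omega> * nn_cond_exp M F U \<omega> + r \<omega> * nn_cond_exp M F V \<omega>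
      + s \<omega> * nn_cond_exp M F Y \<omega>"
proof -
  note [measurable] = F[THEN measurable_from_subalg[OF subalg]]
  have "AE \<omega> in M. nn_cond_exp M F Z \<omega> + nn_cond_exp M F p \<omega> = nn_cond_exp M F (\<lambda>\<omega>. Z \<omega> + p \<omega>) \<omega>"
    by (intro nn_cond_exp_sum) measurable
  moreover have "AE \<omega> in M. nn_cond_exp M F (\<lambda>\<omega>. Z \<omega> + p \<omega>) \<omega> + nn_cond_exp M F (\<lambda>\<omega>. q \<omega> * U \<omega>) \<omega>
      = nn_cond_exp M F (\<lambda>\<omega>. Z \<omega> + p \<omega> + q \<omega> * U \<omega>) \<omega>"
    by (intro nn_cond_exp_sum) measurable
  moreover have "AE \<omega> in M. nn_cond_exp M F (\<lambda>\<omega>. Z \<omega> + p \<omega> + q \<omega> * U \<omega>) \<omega>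
        + nn_cond_exp M F (\<lambda>\<omega>. r \<omega> * V \<omega>) \<omega>
      = nn_cond_exp M F (\<lambda>\<omega>. Z \<omega> + p \<omega> + q \<omega> * U \<omega> + r \<omega> * V \<omega>) \<omega>"
    by (intro nn_cond_exp_sum) measurable
  moreover have "AE \<omega> in M. nn_cond_exp M F (\<lambda>\<omega>. Z \<omega> + p \<omega> + q \<omega> * U \<omega> + r \<omega> * V \<omega>) \<omega>
        + nn_cond_exp M F (\<lambda>\<omega>. s \<omega> * Y \<omega>) \<omega>
      = nn_cond_exp M F (\<lambda>\<omega>. Z \<omega> + p \<omega> + q \<omega> * U \<omega> + r \<omega> * V \<omega> + s \<omega> * Y \<omega>) \<omega>"
    by (intro nn_cond_exp_sum) measurable
  ultimately show ?thesis
    using nn_cond_exp_F_meas[OF F(1)] nn_cond_exp_prod[OF F(2) assms(2)]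
      nn_cond_exp_prod[OF F(3) assms(3)] nn_cond_exp_prod[OF F(4) assms(4)]
    by eventually_elim simp
qed

text \<open>Since \<open>ennreal\<close> truncates at 0, this concerns the positive part of
  \<open>X\<close>; its integral is at most that of the absolute value.\<close>

lemma nn_cond_exp_finite:
  assumes "integrable M X"
  shows "AE \<omega> in M. nn_cond_exp M F (\<lambda>\<omega>. ennreal (X \<omega>)) \<omega> < \<infinity>"
proof -
  have [measurable]: "X \<in> borel_measurable M" using assms by simp
  have "(\<integral>\<^sup>+ \<omega>. nn_cond_exp M F (\<lambda>\<omega>. ennreal (X \<omega>)) \<omega> \<partial>M) = (\<integral>\<^sup>+ \<omega>. ennreal (X \<omega>) \<partial>M)"
    using nn_cond_exp_intg[of "\<lambda>_. 1" "\<lambda>\<omega>. ennreal (X \<omega>)"] by simp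
  also have "\<dots> \<le> (\<integral>\<^sup>+ \<omega>. ennreal (norm (X \<omega>)) \<partial>M)"
    by (intro nn_integral_mono ennreal_leI) simp
  also have "\<dots> < \<infinity>" using assms by (simp add: integrable_iff_bounded)
  finally have "AE \<omega> in M. nn_cond_exp M F (\<lambda>\<omega>. ennreal (X \<omega>)) \<omega> \<noteq> \<infinity>"
    by (intro nn_integral_PInf_AE) auto
  then show ?thesis by (simp add: less_top)
qed

text \<open>Only nonnegative conditional expectations appear, so that no moment of \<open>X\<close> beyond the first
  need exist.\<close>

lemma nn_cond_exp_le_quadratic:
  fixes X a b c Z W :: "'a \<Rightarrow> real"
  assumes X: "integrable M X" "AE \<omega> in M. real_cond_exp M F X \<omega> = 0"
    and [measurable]: "Z \<in> borel_measurable M" "W \<in> borel_measurable M"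
    and F [measurable]: "a \<in> borel_measurable F" "b \<in> borel_measurable F" "c \<in> borel_measurable F"
    and le: "AE \<omega> in M. max 0 (Z \<omega>) \<le> max 0 (W \<omega>) + a \<omega> + b \<omega> * X \<omega> + c \<omega> * (X \<omega>)\<^sup>2"
  shows "AE \<omega> in M. nn_cond_exp M F (\<lambda>\<omega>. ennreal ((X \<omega>)\<^sup>2)) \<omega> < \<infinity> \<longrightarrow>
    nn_cond_exp M F (\<lambda>\<omega>. ennreal (W \<omega>)) \<omega> < \<infinity> \<longrightarrow>
    nn_cond_exp M F (\<lambda>\<omega>. ennreal (Z \<omega>)) \<omega> < \<infinity> \<and>
    enn2real (nn_cond_exp M F (\<lambda>\<omega>. ennreal (Z \<omega>)) \<omega>) \<le>
      enn2real (nn_cond_exp M F (\<lambda>\<omega>. ennreal (W \<omega>)) \<omega>) + a \<omega>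
      + c \<omega> * enn2real (nn_cond_exp M F (\<lambda>\<omega>. ennreal ((X \<omega>)\<^sup>2)) \<omega>)"
proof -
  have [measurable]: "X \<in> borel_measurable M" using X by simp
  note [measurable] = F[THEN measurable_from_subalg[OF subalg]]
  let ?u = "nn_cond_exp M F (\<lambda>\<omega>. ennreal (X \<omega>))" and ?v = "nn_cond_exp M F (\<lambda>\<omega>. ennreal (- X \<omega>))"
  let ?s = "nn_cond_exp M F (\<lambda>\<omega>. ennreal ((X \<omega>)\<^sup>2))"
  let ?Z = "nn_cond_exp M F (\<lambda>\<omega>. ennreal (Z \<omega>))" and ?W = "nn_cond_exp M F (\<lambda>\<omega>. ennreal (W \<omega>))"
  define L where "L \<omega> = ennreal (Z \<omega>) + ennreal (- a \<omega>) + ennreal (- b \<omega>) * ennreal (X \<omega>)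
    + ennreal (b \<omega>) * ennreal (- X \<omega>) + ennreal (- c \<omega>) * ennreal ((X \<omega>)\<^sup>2)" for \<omega>
  define R where "R \<omega> = ennreal (W \<omega>) + ennreal (a \<omega>) + ennreal (b \<omega>) * ennreal (X \<omega>)
    + ennreal (- b \<omega>) * ennreal (- X \<omega>) + ennreal (c \<omega>) * ennreal ((X \<omega>)\<^sup>2)" for \<omega>
  have "AE \<omega> in M. nn_cond_exp M F L \<omega> \<le> nn_cond_exp M F R \<omega>"
  proof (rule nn_cond_exp_mono)
    show "AE \<omega> in M. L \<omega> \<le> R \<omega>"
      using le unfolding L_def R_def by eventually_elim (rule ennreal_le_quadratic)
  qed (unfold L_def R_def, measurable)
  moreover have "AE \<omega> in M. nn_cond_exp M F L \<omega> = ?Z \<omega> + ennreal (- a \<omega>) + ennreal (- b \<omega>) * ?u \<omega>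
      + ennreal (b \<omega>) * ?v \<omega> + ennreal (- c \<omega>) * ?s \<omega>"
    unfolding L_def by (rule nn_cond_exp_linear) measurable
  moreover have "AE \<omega> in M. nn_cond_exp M F R \<omega> = ?W \<omega> + ennreal (a \<omega>) + ennreal (b \<omega>) * ?u \<omega>
      + ennreal (- b \<omega>) * ?v \<omega> + ennreal (c \<omega>) * ?s \<omega>"
    unfolding R_def by (rule nn_cond_exp_linear) measurable
  moreover have "AE \<omega> in M. ?u \<omega> < \<infinity>" by (rule nn_cond_exp_finite[OF X(1)])
  moreover have "AE \<omega> in M. ?v \<omega> < \<infinity>" by (rule nn_cond_exp_finite) (use X in simp)
  ultimately show ?thesis using X(2)
  proof eventually_elim
    case (elim \<omega>)
    define m where "m = enn2real (?u \<omega>)"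
    \<comment> \<open>Conditional mean zero says that the positive and negative parts of
      \<open>X\<close> have the same finite conditional expectation \<open>m\<close>. The terms with
      \<open>b\<close> are therefore equal on both sides and cancel.\<close>
    have m: "?u \<omega> = ennreal m" "?v \<omega> = ennreal m" "0 \<le> m"
    proof -
      have "?u \<omega> = ennreal (enn2real (?u \<omega>))" "?v \<omega> = ennreal (enn2real (?v \<omega>))"
        using elim by simp_all
      moreover have "enn2real (?u \<omega>) = enn2real (?v \<omega>)" using elim by (simp add: real_cond_exp_def)
      ultimately show "?u \<omega> = ennreal m" "?v \<omega> = ennreal m" unfolding m_def by metis+
    qed (simp add: m_def)
    show ?case
    proof (intro impI)
      assume fin: "?s \<omega> < \<infinity>" "?W \<omega> < \<infinity>"
      obtain s where s: "?s \<omega> = ennreal s" "0 \<le> s" using fin(1) by (cases "?s \<omega>") auto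
      obtain w where w: "?W \<omega> = ennreal w" "0 \<le> w" using fin(2) by (cases "?W \<omega>") auto
      have le: "?Z \<omega> + ennreal (- a \<omega>) + ennreal (- b \<omega>) * ennreal m
          + ennreal (b \<omega>) * ennreal m + ennreal (- c \<omega>) * ennreal s
        \<le> ennreal w + ennreal (a \<omega>) + ennreal (b \<omega>) * ennreal m
          + ennreal (- b \<omega>) * ennreal m + ennreal (c \<omega>) * ennreal s"
        using elim m s w by simp
      \<comment> \<open>Finiteness is derived and not assumed: \<open>?Z\<close> is a summand of the
        left side, and the right side is finite.\<close>
      have "?Z \<omega> \<le> ennreal w + ennreal (a \<omega>) + ennreal (b \<omega>) * ennreal m
          + ennreal (- b \<omega>) * ennreal m + ennreal (c \<omega>) * ennreal s"
        using le by (rule order_trans[rotated]) (simp add: add.assoc)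
      also have "\<dots> < \<infinity>" by (simp add: ennreal_mult_less_top)
      finally have Zf: "?Z \<omega> < \<infinity>" .
      then obtain z where z: "?Z \<omega> = ennreal z" "0 \<le> z" by (cases "?Z \<omega>") auto
      obtain ap an where a: "0 \<le> ap" "0 \<le> an" "a \<omega> = ap - an"
          "ennreal (a \<omega>) = ennreal ap" "ennreal (- a \<omega>) = ennreal an"
        by (rule pos_neg_parts)
      obtain bp bn where b: "0 \<le> bp" "0 \<le> bn"
          "ennreal (b \<omega>) = ennreal bp" "ennreal (- b \<omega>) = ennreal bn"
        by (rule pos_neg_parts)
      obtain cp cn where c: "0 \<le> cp" "0 \<le> cn" "c \<omega> = cp - cn"
          "ennreal (c \<omega>) = ennreal cp" "ennreal (- c \<omega>) = ennreal cn"
        by (rule pos_neg_parts)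
      have "ennreal (z + an + bn * m + bp * m + cn * s) \<le> ennreal (w + ap + bp * m + bn * m + cp * s)"
        using le[unfolded z a(4,5) b(3,4) c(4,5)] a(1,2) b(1,2) c(1,2) s(2) w(2) z(2) m(3)
        by (simp only: ennreal_linear)
      then have "z + an + bn * m + bp * m + cn * s \<le> w + ap + bp * m + bn * m + cp * s"
        by (rule ennreal_le_iff[THEN iffD1, rotated]) (use a b c m s w in simp)
      then have "z \<le> w + a \<omega> + c \<omega> * s" unfolding a(3) c(3) by (simp add: algebra_simps)
      then show "?Z \<omega> < \<infinity> \<and> enn2real (?Z \<omega>) \<le> enn2real (?W \<omega>) + a \<omega> + c \<omega> * enn2real (?s \<omega>)"
        using Zf s w z by simp
    qed
  qed
qed

section \<open>Bounds on conditional moments and the one-step comparison\<close>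

lemma nn_cond_exp_third_moment_le:
  fixes X :: "'a \<Rightarrow> real"
  assumes X: "integrable M X" "AE \<omega> in M. real_cond_exp M F X \<omega> = 0" "AE \<omega> in M. X \<omega> \<le> 1"
  defines "v \<equiv> nn_cond_exp M F (\<lambda>\<omega>. ennreal ((X \<omega>)\<^sup>2))"
  shows "AE \<omega> in M. v \<omega> < \<infinity> \<longrightarrow> nn_cond_exp M F (\<lambda>\<omega>. ennreal ((X \<omega>)^3)) \<omega> < \<infinity> \<and>
    (nn_cond_exp M F (\<lambda>\<omega>. ennreal (- ((X \<omega>)^3))) \<omega> < \<infinity> \<longrightarrow>
     enn2real (nn_cond_exp M F (\<lambda>\<omega>. ennreal ((X \<omega>)^3)) \<omega>)
       \<le> enn2real (nn_cond_exp M F (\<lambda>\<omega>. ennreal (- ((X \<omega>)^3))) \<omega>)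
         + enn2real (v \<omega>) - (enn2real (v \<omega>))\<^sup>2)"
proof -
  have [measurable]: "X \<in> borel_measurable M" using X by simp
  have [measurable]: "v \<in> borel_measurable F" unfolding v_def by simp
  define l where "l \<omega> = enn2real (v \<omega>)" for \<omega>
  have [measurable]: "l \<in> borel_measurable F" unfolding l_def by measurable
  \<comment> \<open>The constant bound 1 for the positive part of \<open>X^3\<close> makes its
    conditional expectation finite, whatever the negative part does.\<close>
  have "AE \<omega> in M. v \<omega> < \<infinity> \<longrightarrow> nn_cond_exp M F (\<lambda>\<omega>. ennreal 0) \<omega> < \<infinity> \<longrightarrow>
      nn_cond_exp M F (\<lambda>\<omega>. ennreal ((X \<omega>)^3)) \<omega> < \<infinity> \<and>
      enn2real (nn_cond_exp M F (\<lambda>\<omega>. ennreal ((X \<omega>)^3)) \<omega>)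
       \<le> enn2real (nn_cond_exp M F (\<lambda>\<omega>. ennreal 0) \<omega>) + 1 + 0 * enn2real (v \<omega>)"
    unfolding v_def
  proof (rule nn_cond_exp_le_quadratic[where b = "\<lambda>_. 0"])
    show "AE \<omega> in M. max 0 ((X \<omega>) ^ 3) \<le> max 0 0 + 1 + 0 * X \<omega> + 0 * (X \<omega>)\<^sup>2"
      using X(3)
    proof eventually_elim
      case (elim \<omega>)
      then have "(X \<omega>)^3 \<le> 1^3" by (intro power_mono_odd) auto
      then show ?case by simp
    qed
  qed (use X in simp_all)
  moreover have "AE \<omega> in M. v \<omega> < \<infinity> \<longrightarrow> nn_cond_exp M F (\<lambda>\<omega>. ennreal (- ((X \<omega>)^3))) \<omega> < \<infinity> \<longrightarrow>
      nn_cond_exp M F (\<lambda>\<omega>. ennreal ((X \<omega>)^3)) \<omega> < \<infinity> \<and>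
      enn2real (nn_cond_exp M F (\<lambda>\<omega>. ennreal ((X \<omega>)^3)) \<omega>)
       \<le> enn2real (nn_cond_exp M F (\<lambda>\<omega>. ennreal (- ((X \<omega>)^3))) \<omega>)
         + (l \<omega>)\<^sup>2 + (1 - 2 * l \<omega>) * enn2real (v \<omega>)"
    unfolding v_def
  \<comment> \<open>The coefficients come from expanding \<open>(1 - X) * (X + l)^2\<close> with the
    random but \<open>F\<close>-measurable \<open>l\<close>, the conditional variance. The negative
    part of \<open>X^3\<close> takes the place of \<open>W\<close>, and the mean of the quadratic is
    \<open>l - l^2\<close>.\<close>
  proof (rule nn_cond_exp_le_quadratic[where b = "\<lambda>\<omega>. 2 * l \<omega> - (l \<omega>)\<^sup>2"])
    show "AE \<omega> in M. max 0 ((X \<omega>) ^ 3) \<le> max 0 (- ((X \<omega>) ^ 3)) + (l \<omega>)\<^sup>2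
        + (2 * l \<omega> - (l \<omega>)\<^sup>2) * X \<omega> + (1 - 2 * l \<omega>) * (X \<omega>)\<^sup>2"
      using X(3)
    proof eventually_elim
      case (elim \<omega>)
      have "0 \<le> (1 - X \<omega>) * (X \<omega> + l \<omega>)\<^sup>2" using elim by simp
      moreover have "max 0 ((X \<omega>) ^ 3) = max 0 (- ((X \<omega>) ^ 3)) + (X \<omega>) ^ 3" by (simp add: max_def)
      ultimately show ?case by (simp add: algebra_simps power2_eq_square power3_eq_cube)
    qed
  qed (use X in simp_all)
  moreover have "AE \<omega> in M. nn_cond_exp M F (\<lambda>\<omega>. ennreal 0) \<omega> < \<infinity>"
    by (rule nn_cond_exp_finite) simp
  ultimately show ?thesis
    by eventually_elim (auto simp: l_def algebra_simps power2_eq_square)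
qed

lemma nn_cond_exp_fourth_moment_ge:
  fixes X :: "'a \<Rightarrow> real"
  assumes X: "integrable M X" "AE \<omega> in M. real_cond_exp M F X \<omega> = 0" "AE \<omega> in M. X \<omega> \<le> 1"
  defines "v \<equiv> nn_cond_exp M F (\<lambda>\<omega>. ennreal ((X \<omega>)\<^sup>2))"
  shows "AE \<omega> in M. v \<omega> < \<infinity> \<longrightarrow> nn_cond_exp M F (\<lambda>\<omega>. ennreal ((X \<omega>)^4)) \<omega> < \<infinity> \<longrightarrow>
    1 \<le> enn2real (v \<omega>) \<longrightarrow> (enn2real (v \<omega>))^3 - (enn2real (v \<omega>))\<^sup>2 + enn2real (v \<omega>)
       \<le> enn2real (nn_cond_exp M F (\<lambda>\<omega>. ennreal ((X \<omega>)^4)) \<omega>)"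
proof -
  have [measurable]: "X \<in> borel_measurable M" using X by simp
  have [measurable]: "v \<in> borel_measurable F" unfolding v_def by simp
  \<comment> \<open>The truncation at 1 keeps the polynomial inequality valid at every point; where
    the variance is at least 1, \<open>l\<close> is the variance itself.\<close>
  define l where "l \<omega> = max 1 (enn2real (v \<omega>))" for \<omega>
  have [measurable]: "l \<in> borel_measurable F" unfolding l_def by measurable
  have "AE \<omega> in M. v \<omega> < \<infinity> \<longrightarrow> nn_cond_exp M F (\<lambda>\<omega>. ennreal ((X \<omega>)^4)) \<omega> < \<infinity> \<longrightarrow>
      nn_cond_exp M F (\<lambda>\<omega>. ennreal 0) \<omega> < \<infinity> \<and>
      enn2real (nn_cond_exp M F (\<lambda>\<omega>. ennreal 0) \<omega>)
       \<le> enn2real (nn_cond_exp M F (\<lambda>\<omega>. ennreal ((X \<omega>)^4)) \<omega>)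
         + (l \<omega>)\<^sup>2 * (2 * l \<omega> - 1) + - (3 * (l \<omega>)\<^sup>2 - 2 * l \<omega> + 1) * enn2real (v \<omega>)"
    unfolding v_def
  \<comment> \<open>The factor \<open>2 * l - 1 - X\<close> is the one for which
    \<open>(1 - X) * (2 * l - 1 - X) * (X + l)^2\<close> has no cubic term, so the fourth moment
    \<open>W\<close> and a quadratic suffice.\<close>
  proof (rule nn_cond_exp_le_quadratic[where b = "\<lambda>\<omega>. - 2 * l \<omega> * (l \<omega> - 1)\<^sup>2"])
    show "AE \<omega> in M. max 0 0 \<le> max 0 ((X \<omega>) ^ 4) + (l \<omega>)\<^sup>2 * (2 * l \<omega> - 1)
        + - 2 * l \<omega> * (l \<omega> - 1)\<^sup>2 * X \<omega> + - (3 * (l \<omega>)\<^sup>2 - 2 * l \<omega> + 1) * (X \<omega>)\<^sup>2"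
      using X(3)
    proof eventually_elim
      case (elim \<omega>)
      have "1 \<le> l \<omega>" by (simp add: l_def)
      then have "0 \<le> (1 - X \<omega>) * (2 * l \<omega> - 1 - X \<omega>) * (X \<omega> + l \<omega>)\<^sup>2" using elim by simp
      also have "\<dots> = (X \<omega>) ^ 4 + (l \<omega>)\<^sup>2 * (2 * l \<omega> - 1)
        + - 2 * l \<omega> * (l \<omega> - 1)\<^sup>2 * X \<omega> + - (3 * (l \<omega>)\<^sup>2 - 2 * l \<omega> + 1) * (X \<omega>)\<^sup>2"
        by (simp add: algebra_simps power2_eq_square power4_eq_xxxx)
      finally show ?case by simp
    qed
  qed (use X in simp_all)
  then show ?thesis
  proof eventually_elim
    case (elim \<omega>)
    show ?case
    proof (intro impI)
      assume *: "v \<omega> < \<infinity>" "nn_cond_exp M F (\<lambda>\<omega>. ennreal ((X \<omega>)^4)) \<omega> < \<infinity>" "1 \<le> enn2real (v \<omega>)"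
      then have l: "l \<omega> = enn2real (v \<omega>)" by (simp add: l_def)
      have "0 \<le> enn2real (nn_cond_exp M F (\<lambda>\<omega>. ennreal 0) \<omega>)" by simp
      also have "\<dots> \<le> enn2real (nn_cond_exp M F (\<lambda>\<omega>. ennreal ((X \<omega>)^4)) \<omega>)
         + (l \<omega>)\<^sup>2 * (2 * l \<omega> - 1) + - (3 * (l \<omega>)\<^sup>2 - 2 * l \<omega> + 1) * enn2real (v \<omega>)"
        using elim * by blast
      finally show "(enn2real (v \<omega>))^3 - (enn2real (v \<omega>))\<^sup>2 + enn2real (v \<omega>)
         \<le> enn2real (nn_cond_exp M F (\<lambda>\<omega>. ennreal ((X \<omega>)^4)) \<omega>)"
        unfolding l by (simp add: algebra_simps power2_eq_square power3_eq_cube)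
    qed
  qed
qed

lemma nn_integral_convex_deriv_step:
  fixes X U :: "'a \<Rightarrow> real"
  assumes X: "integrable M X" "AE \<omega> in M. real_cond_exp M F X \<omega> = 0" "AE \<omega> in M. X \<omega> \<le> 1"
    and v: "AE \<omega> in M. nn_cond_exp M F (\<lambda>\<omega>. ennreal ((X \<omega>)\<^sup>2)) \<omega> \<le> ennreal a"
    and a: "0 \<le> a" and U [measurable]: "U \<in> borel_measurable F" and f: "convex_deriv f"
  shows "(\<integral>\<^sup>+ \<omega>. ennreal (f (U \<omega> + X \<omega>)) \<partial>M) \<le> (\<integral>\<^sup>+ \<omega>. ennreal (bernoulli_mean a f (U \<omega>)) \<partial>M)"
proof -
  have [measurable]: "X \<in> borel_measurable M" using X by simp
  have [measurable]: "U \<in> borel_measurable M" by (rule measurable_from_subalg[OF subalg U])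
  have [measurable]: "f \<in> borel_measurable borel" using f by (rule convex_deriv_measurable)
  obtain A B C where [measurable]: "A \<in> borel_measurable borel" "B \<in> borel_measurable borel"
      "C \<in> borel_measurable borel"
    and C: "\<And>t. 0 \<le> C t" and maj: "\<And>t y. y \<le> 1 \<Longrightarrow> f (t + y) \<le> A t + B t * y + C t * y\<^sup>2"
    and mean: "\<And>t. A t + C t * a = bernoulli_mean a f t"
    using quadratic_majorant[OF f a] by metis
  let ?Z = "nn_cond_exp M F (\<lambda>\<omega>. ennreal (f (U \<omega> + X \<omega>)))"
  let ?v = "nn_cond_exp M F (\<lambda>\<omega>. ennreal ((X \<omega>)\<^sup>2))"
  have "AE \<omega> in M. ?v \<omega> < \<infinity> \<longrightarrow> nn_cond_exp M F (\<lambda>\<omega>. ennreal 0) \<omega> < \<infinity> \<longrightarrow> ?Z \<omega> < \<infinity> \<and>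
      enn2real (?Z \<omega>) \<le> enn2real (nn_cond_exp M F (\<lambda>\<omega>. ennreal 0) \<omega>) + A (U \<omega>)
        + C (U \<omega>) * enn2real (?v \<omega>)"
  \<comment> \<open>The majorant is taken at the random point \<open>U\<close>, whose
    \<open>F\<close>-measurability makes the coefficients \<open>F\<close>-measurable.\<close>
  proof (rule nn_cond_exp_le_quadratic[where b = "\<lambda>\<omega>. B (U \<omega>)"])
    show "AE \<omega> in M. max 0 (f (U \<omega> + X \<omega>)) \<le> max 0 0 + A (U \<omega>) + B (U \<omega>) * X \<omega> + C (U \<omega>) * (X \<omega>)\<^sup>2"
      using X(3)
    proof eventually_elim
      case (elim \<omega>)
      then show ?case using maj[OF elim, of "U \<omega>"] f by (simp add: convex_deriv_def)
    qed
  qed (use X in simp_all)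
  moreover have "AE \<omega> in M. 0 = nn_cond_exp M F (\<lambda>\<omega>. ennreal 0) \<omega>"
    using nn_cond_exp_F_meas[of "\<lambda>_. 0"] by simp
  ultimately have "AE \<omega> in M. ?Z \<omega> \<le> ennreal (bernoulli_mean a f (U \<omega>))"
    using v
  proof eventually_elim
    case (elim \<omega>)
    have fin: "?v \<omega> < \<infinity>" using elim(3) by (rule le_less_trans) simp
    then have Z: "?Z \<omega> < \<infinity>" "enn2real (?Z \<omega>) \<le> A (U \<omega>) + C (U \<omega>) * enn2real (?v \<omega>)"
      using elim by (auto simp flip: elim(2))
    have "enn2real (?v \<omega>) \<le> a" using elim(3) a by (metis enn2real_ennreal enn2real_mono ennreal_less_top)
    \<comment> \<open>Here the sign of \<open>C\<close> lets the conditional variance be replaced by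
      its upper bound \<open>a\<close>.\<close>
    then have "C (U \<omega>) * enn2real (?v \<omega>) \<le> C (U \<omega>) * a" by (intro mult_left_mono C)
    then have "enn2real (?Z \<omega>) \<le> bernoulli_mean a f (U \<omega>)" using Z mean[of "U \<omega>"] by linarith
    then have "ennreal (enn2real (?Z \<omega>)) \<le> ennreal (bernoulli_mean a f (U \<omega>))" by (rule ennreal_leI)
    then show ?case using Z by simp
  qed
  then have "(\<integral>\<^sup>+ \<omega>. ?Z \<omega> \<partial>M) \<le> (\<integral>\<^sup>+ \<omega>. ennreal (bernoulli_mean a f (U \<omega>)) \<partial>M)"
    by (rule nn_integral_mono_AE)
  also have "(\<integral>\<^sup>+ \<omega>. ?Z \<omega> \<partial>M) = (\<integral>\<^sup>+ \<omega>. ennreal (f (U \<omega> + X \<omega>)) \<partial>M)"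
    using nn_cond_exp_intg[of "\<lambda>_. 1" "\<lambda>\<omega>. ennreal (f (U \<omega> + X \<omega>))"] by simp
  finally show ?thesis .
qed

end

section \<open>From skewness and kurtosis to a variance bound\<close>

lemma skew_kurt_bound_infinity [simp]:
  "skew_bound \<infinity> = 0" "skew_bound (- \<infinity>) = \<infinity>" "kurt_bound \<infinity> = \<infinity>"
  using skew_bound.simps(2,3) kurt_bound.simps(2)
  by (simp_all only: infinity_ereal_def uminus_ereal.simps)

text \<open>With \<open>s = sqrt l\<close> and a finite lower bound \<open>g\<close>, the hypotheses
  give \<open>g\<close> \<le> \<open>1 / s - s\<close>, that is \<open>s^2 + g * s - 1\<close> \<le>
  0. So \<open>s\<close> is at most the positive root, which is \<open>u(g)\<close>.\<close>

lemma le_skew_bound_square: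
  assumes "0 < l" "\<gamma> \<le> ereal t / ereal (sqrt l ^ 3)" "t \<le> l - l\<^sup>2"
  shows "ereal l \<le> (skew_bound \<gamma>)\<^sup>2"
proof (cases \<gamma>)
  case (real g)
  define s where "s = sqrt l"
  have s: "0 < s" "l = s\<^sup>2" using assms(1) by (auto simp: s_def)
  have "g \<le> t / s ^ 3" using assms(2) s real by (simp add: s_def[symmetric])
  also have "\<dots> \<le> (s\<^sup>2 - s ^ 4) / s ^ 3" using assms(3) s by (intro divide_right_mono) auto
  also have "\<dots> = 1 / s - s" using s(1) by (simp add: field_simps power2_eq_square power3_eq_cube power4_eq_xxxx)
  finally have "g * s \<le> 1 - s\<^sup>2" using s by (simp add: field_simps power2_eq_square)
  then have "(s + g / 2)\<^sup>2 \<le> 1 + g\<^sup>2 / 4" by (simp add: power2_eq_square algebra_simps)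
  then have "s + g / 2 \<le> sqrt (1 + g\<^sup>2 / 4)" by (rule real_le_rsqrt)
  then have "s \<le> sqrt (1 + g\<^sup>2 / 4) - g / 2" by simp
  then have "s\<^sup>2 \<le> (sqrt (1 + g\<^sup>2 / 4) - g / 2)\<^sup>2" using s by (intro power_mono) auto
  then show ?thesis using real s by (simp add: power2_eq_square)
next
  case PInf
  \<comment> \<open>An infinite lower bound is impossible here, because the skewness is
    finite.\<close>
  have "ereal t / ereal (sqrt l ^ 3) = ereal (t / sqrt l ^ 3)" using assms(1) by simp
  then show ?thesis using assms(2) PInf by simp
next
  case MInf
  then show ?thesis by (simp add: power2_eq_square)
qed

text \<open>For \<open>l\<close> at least 1 and finite \<open>t\<close>, the moment inequality
  becomes \<open>l^2 - (t + 1) * l + 1\<close> \<le> 0, and \<open>v(t)\<close> is the larger root.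
  For smaller \<open>l\<close> it suffices that \<open>v(t)\<close> is at least
  \<open>(t + 1) / 2\<close>, hence at least 1.\<close>

lemma le_kurt_bound:
  assumes "0 < l" "1 \<le> \<kappa>" "ereal m / ereal (sqrt l ^ 4) \<le> \<kappa>" "1 \<le> l \<Longrightarrow> l ^ 3 - l\<^sup>2 + l \<le> m"
  shows "ereal l \<le> kurt_bound \<kappa>"
proof (cases \<kappa>)
  case (real t)
  have t: "1 \<le> t" using assms(2) real by simp
  then have t4: "0 \<le> (t + 1)\<^sup>2 - 4" using power_mono[of 2 "t + 1" 2] by simp
  have "l \<le> (t + 1 + sqrt ((t + 1)\<^sup>2 - 4)) / 2"
  proof (cases "1 \<le> l")
    case True
    have s4: "sqrt l ^ 4 = l\<^sup>2" using assms(1)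
      by (metis less_imp_le numeral_Bit0 power_mult real_sqrt_pow2 mult_2)
    have "m \<le> t * l\<^sup>2" using assms(1,3) real by (simp add: s4 field_simps)
    then have "l ^ 3 - l\<^sup>2 + l \<le> t * l\<^sup>2" using assms(4) True by simp
    then have "l * (l\<^sup>2 + 1) \<le> l * ((t + 1) * l)"
      by (simp add: algebra_simps power2_eq_square power3_eq_cube)
    then have "l\<^sup>2 + 1 \<le> (t + 1) * l" using assms(1) by simp
    then have "(2 * l - (t + 1))\<^sup>2 \<le> (t + 1)\<^sup>2 - 4" by (simp add: power2_eq_square algebra_simps)
    then have "2 * l - (t + 1) \<le> sqrt ((t + 1)\<^sup>2 - 4)" by (rule real_le_rsqrt)
    then show ?thesis by simp
  next
    case False
    have "l * 2 \<le> t + 1" using False t by simp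
    moreover have "0 \<le> sqrt ((t + 1)\<^sup>2 - 4)" using t4 by simp
    ultimately show ?thesis by (simp only: le_divide_eq_numeral1 add_increasing2)
  qed
  then show ?thesis using real by simp
qed (use assms in auto)

text \<open>Where the conditional variance is 0, the conventions for skewness and kurtosis carry no
  information; the \<open>max 0\<close> in the bound settles that case at once.\<close>

lemma cond_variance_le_Min:
  assumes "sigma_finite_subalgebra M G"
    and X: "integrable M X" "AE \<omega> in M. real_cond_exp M G X \<omega> = 0" "AE \<omega> in M. X \<omega> \<le> 1"
    and fin: "AE \<omega> in M. cond_variance M G X \<omega> < \<infinity>"
    and var: "AE \<omega> in M. cond_variance M G X \<omega> \<le> \<sigma>2"
    and skew: "AE \<omega> in M. \<gamma> \<le> cond_skewness M G X \<omega>"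
    and kurt: "AE \<omega> in M. cond_kurtosis M G X \<omega> \<le> \<kappa>"
    and \<kappa>: "1 \<le> \<kappa>"
  shows "AE \<omega> in M. cond_variance M G X \<omega> \<le> max 0 (Min {\<sigma>2, (skew_bound \<gamma>)\<^sup>2, kurt_bound \<kappa>})"
proof -
  interpret sigma_finite_subalgebra M G by fact
  show ?thesis
    using nn_cond_exp_third_moment_le[OF X] nn_cond_exp_fourth_moment_ge[OF X] fin var skew kurt
  proof eventually_elim
    case (elim \<omega>)
    let ?v = "nn_cond_exp M G (\<lambda>\<omega>. ennreal ((X \<omega>)\<^sup>2)) \<omega>"
    let ?p = "nn_cond_exp M G (\<lambda>\<omega>. ennreal ((X \<omega>)^3)) \<omega>"
    let ?q = "nn_cond_exp M G (\<lambda>\<omega>. ennreal (- ((X \<omega>)^3))) \<omega>"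
    let ?m = "nn_cond_exp M G (\<lambda>\<omega>. ennreal ((X \<omega>)^4)) \<omega>"
    obtain l where l: "?v = ennreal l" "0 \<le> l"
      using elim(3) unfolding cond_variance_def
      by (cases ?v) auto
    have var_l: "cond_variance M G X \<omega> = ereal l" and sd: "cond_sd M G X \<omega> = sqrt l"
      using l by (simp_all add: cond_variance_def cond_sd_def)
    show ?case
    proof (cases "l = 0")
      case True
      then show ?thesis by (simp add: var_l flip: zero_ereal_def)
    next
      case False
      then have l0: "0 < l" using l by simp
      obtain p where p: "?p = ennreal p" "0 \<le> p"
        using elim(1) l by (cases ?p) auto
      have "ereal l \<le> (skew_bound \<gamma>)\<^sup>2"
      proof (cases ?q)
        case (real q)
        have "\<gamma> \<le> ereal (p - q) / ereal (sqrt l ^ 3)"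
          using elim(5) l0 p real by (simp add: cond_skewness_def sd cond_third_moment_def)
        moreover have "p - q \<le> l - l\<^sup>2" using elim(1) l p real by simp
        ultimately show ?thesis by (rule le_skew_bound_square[OF l0])
      next
        \<comment> \<open>The negative part of the cube has infinite conditional expectation while
          the positive part stays finite. The skewness is then -\<infinity>, so \<gamma> is too, and
          the bound to be shown is infinite.\<close>
        case top
        then have "\<gamma> = - \<infinity>"
          using elim(5) l0 p by (simp add: cond_skewness_def sd cond_third_moment_def)
        then show ?thesis by (simp add: power2_eq_square)
      qed
      moreover have "ereal l \<le> kurt_bound \<kappa>"
      proof (cases ?m)
        case (real m)
        show ?thesis
        proof (rule le_kurt_bound[OF l0 \<kappa>])
          show "ereal m / ereal (sqrt l ^ 4) \<le> \<kappa>"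
            using elim(6) l0 real by (simp add: cond_kurtosis_def sd cond_fourth_moment_def)
          show "l ^ 3 - l\<^sup>2 + l \<le> m" if "1 \<le> l" using elim(2) l real that by simp
        qed
      next
        case top
        then have "\<kappa> = \<infinity>"
          using elim(6) l0 by (simp add: cond_kurtosis_def sd cond_fourth_moment_def)
        then show ?thesis by simp
      qed
      ultimately show ?thesis using elim(4) by (simp add: var_l le_max_iff_disj)
    qed
  qed
qed

section \<open>Sums of independent Bernoulli variables\<close>

lemma nn_integral_bernoulli_var:
  assumes "prob_space N" "bernoulli_var N a Y" "0 \<le> a" "\<And>x. 0 \<le> f x" "f \<in> borel_measurable borel"
  shows "(\<integral>\<^sup>+ \<omega>. ennreal (f (t + Y \<omega>)) \<partial>N) = ennreal (bernoulli_mean a f t)"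
proof -
  interpret prob_space N by fact
  note [measurable] = assms(5)
  have Y [measurable]: "Y \<in> borel_measurable N"
    and P: "prob {\<omega> \<in> space N. Y \<omega> = - a} = 1 / (1 + a)" "prob {\<omega> \<in> space N. Y \<omega> = 1} = a / (1 + a)"
    using assms(2) by (auto simp: bernoulli_var_def)
  let ?A = "{\<omega> \<in> space N. Y \<omega> = - a}" and ?B = "{\<omega> \<in> space N. Y \<omega> = 1}"
  \<comment> \<open>The two values are distinct because \<open>- a\<close> is at most 0, and their
    probabilities add up to 1; so \<open>Y\<close> almost surely takes no other value.\<close>
  have "prob (?A \<union> ?B) = prob ?A + prob ?B"
    by (intro finite_measure_Union) (use assms(3) in auto)
  also have "\<dots> = 1" using assms(3) by (simp add: P flip: add_divide_distrib)
  finally have "AE \<omega> in N. \<omega> \<in> ?A \<union> ?B" by (intro AE_prob_1) simp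
  then have "AE \<omega> in N. ennreal (f (t + Y \<omega>)) =
      ennreal (f (t - a)) * indicator ?A \<omega> + ennreal (f (t + 1)) * indicator ?B \<omega>"
    by eventually_elim (use assms(3) in \<open>auto simp: indicator_def\<close>)
  then have "(\<integral>\<^sup>+ \<omega>. ennreal (f (t + Y \<omega>)) \<partial>N) =
      (\<integral>\<^sup>+ \<omega>. ennreal (f (t - a)) * indicator ?A \<omega> + ennreal (f (t + 1)) * indicator ?B \<omega> \<partial>N)"
    by (rule nn_integral_cong_AE)
  also have "\<dots> = ennreal (f (t - a)) * emeasure N ?A + ennreal (f (t + 1)) * emeasure N ?B"
    by (simp add: nn_integral_add nn_integral_cmult_indicator)
  also have "\<dots> = ennreal (bernoulli_mean a f t)"
    using assms(3,4)
    by (simp add: emeasure_eq_measure P bernoulli_mean_def add_divide_distrib mult.commute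
        flip: ennreal_mult ennreal_plus)
  finally show ?thesis .
qed

text \<open>The last variable is independent of the preceding partial sum, so Fubini integrates it
  out and turns \<open>f\<close> into \<open>bernoulli_mean a f\<close>. The induction hypothesis is
  then used for this new test function.\<close>

lemma nn_integral_sum_bernoulli_var:
  assumes N: "prob_space N" and indep: "prob_space.indep_vars N (\<lambda>_. borel) Y {1..n}"
    and Y: "\<And>k. k \<in> {1..n} \<Longrightarrow> bernoulli_var N a (Y k)" and a: "0 \<le> a" and k: "k \<le> n"
    and f: "convex_deriv f"
  shows "(\<integral>\<^sup>+ \<omega>. ennreal (f (\<Sum>i=1..k. Y i \<omega>)) \<partial>N)
    = ennreal (fold_mset bernoulli_mean f (replicate_mset k a) 0)"
  using k f
proof (induction k arbitrary: f)
  case 0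
  interpret prob_space N by fact
  show ?case by (simp add: emeasure_space_1)
next
  case (Suc k)
  interpret prob_space N by fact
  have [measurable]: "f \<in> borel_measurable borel" using Suc.prems by (simp add: convex_deriv_measurable)
  have Yk: "bernoulli_var N a (Y (Suc k))" using Y Suc.prems by simp
  let ?U = "\<lambda>\<omega>. \<Sum>i=1..k. Y i \<omega>"
  have "indep_vars (\<lambda>_. borel) Y (insert (Suc k) {1..k})"
    by (rule indep_vars_subset[OF indep]) (use Suc.prems in auto)
  then have ind: "indep_var borel (Y (Suc k)) borel ?U"
    by (intro indep_vars_sum) auto
  then have [measurable]: "Y (Suc k) \<in> borel_measurable N" "?U \<in> borel_measurable N"
    by (auto dest: indep_var_rv1 indep_var_rv2)
  interpret U: prob_space "distr N borel ?U" by (rule prob_space_distr) measurable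
  have pair: "distr N borel (Y (Suc k)) \<Otimes>\<^sub>M distr N borel ?U
      = distr N (borel \<Otimes>\<^sub>M borel) (\<lambda>\<omega>. (Y (Suc k) \<omega>, ?U \<omega>))"
    using ind by (simp add: indep_var_distribution_eq)
  interpret V: prob_space "distr N borel (Y (Suc k))" by (rule prob_space_distr) measurable
  interpret pair_sigma_finite "distr N borel (Y (Suc k))" "distr N borel ?U" ..
  have "(\<integral>\<^sup>+ \<omega>. ennreal (f (\<Sum>i=1..Suc k. Y i \<omega>)) \<partial>N)
      = (\<integral>\<^sup>+ \<omega>. (\<lambda>(y, u). ennreal (f (u + y))) (Y (Suc k) \<omega>, ?U \<omega>) \<partial>N)"
    by simp
  also have "\<dots> = (\<integral>\<^sup>+ (y, u). ennreal (f (u + y)) \<partial>(distr N borel (Y (Suc k)) \<Otimes>\<^sub>M distr N borel ?U))"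
    unfolding pair by (subst nn_integral_distr) (auto simp del: One_nat_def)
  also have "\<dots> = (\<integral>\<^sup>+ u. \<integral>\<^sup>+ y. ennreal (f (u + y)) \<partial>distr N borel (Y (Suc k)) \<partial>distr N borel ?U)"
    by (subst nn_integral_snd[symmetric]) auto
  also have "\<dots> = (\<integral>\<^sup>+ u. ennreal (bernoulli_mean a f u) \<partial>distr N borel ?U)"
    using Suc.prems nn_integral_bernoulli_var[OF N Yk a, of f]
    by (simp add: nn_integral_distr convex_deriv_def)
  also have "\<dots> = (\<integral>\<^sup>+ \<omega>. ennreal (bernoulli_mean a f (?U \<omega>)) \<partial>N)"
    unfolding bernoulli_mean_def by (subst nn_integral_distr) (auto simp del: One_nat_def)
  also have "\<dots> = ennreal (fold_mset bernoulli_mean (bernoulli_mean a f) (replicate_mset k a) 0)"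
    using Suc.prems a by (intro Suc.IH convex_deriv_bernoulli_mean) auto
  finally show ?case by (simp add: bernoulli_mean.fold_mset_fun_left_comm)
qed

section \<open>Comparison of the martingale with the Bernoulli sum\<close>

lemma martingale_upto_difference:
  assumes "prob_space M" "martingale_upto M n F S" "Suc k \<le> n"
  shows "sigma_finite_subalgebra M (F k)" "integrable M (\<lambda>\<omega>. S (Suc k) \<omega> - S k \<omega>)"
    "AE \<omega> in M. real_cond_exp M (F k) (\<lambda>\<omega>. S (Suc k) \<omega> - S k \<omega>) \<omega> = 0"
proof -
  interpret prob_space M by fact
  have sub: "subalgebra M (F k)" and int: "integrable M (S k)" "integrable M (S (Suc k))"
    and meas: "S k \<in> borel_measurable (F k)"
    and mart: "AE \<omega> in M. real_cond_exp M (F k) (S (Suc k)) \<omega> = S k \<omega>"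
    using assms(2,3) by (auto simp: martingale_upto_def filtration_upto_def)
  interpret finite_measure_subalgebra M "F k" by unfold_locales (rule sub)
  show "sigma_finite_subalgebra M (F k)" by unfold_locales
  show "integrable M (\<lambda>\<omega>. S (Suc k) \<omega> - S k \<omega>)" using int by simp
  show "AE \<omega> in M. real_cond_exp M (F k) (\<lambda>\<omega>. S (Suc k) \<omega> - S k \<omega>) \<omega> = 0"
    using mart real_cond_exp_diff[OF int(2,1)] real_cond_exp_F_meas[OF int(1) meas]
    by eventually_elim simp
qed

text \<open>Conditioning on \<open>F k\<close> integrates out the last difference at the cost of
  replacing \<open>f\<close> by its Bernoulli mean. This stays in the class, so the induction, with
  \<open>f\<close> arbitrary, continues with \<open>S k\<close>.\<close>

lemma nn_integral_martingale_le:
  fixes X S :: "nat \<Rightarrow> 'a \<Rightarrow> real"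
  assumes M: "prob_space M" and mart: "martingale_upto M n F S"
    and S: "\<And>k \<omega>. S k \<omega> = (\<Sum>i=1..k. X i \<omega>)"
    and X: "\<And>k. k \<in> {1..n} \<Longrightarrow> AE \<omega> in M. X k \<omega> \<le> 1"
    and v: "\<And>k. k \<in> {1..n} \<Longrightarrow> AE \<omega> in M. cond_variance M (F (k - 1)) (X k) \<omega> \<le> ereal (a k)"
    and a: "\<And>k. k \<in> {1..n} \<Longrightarrow> 0 \<le> a k" and k: "k \<le> n" and f: "convex_deriv f"
  shows "(\<integral>\<^sup>+ \<omega>. ennreal (f (S k \<omega>)) \<partial>M)
    \<le> ennreal (fold_mset bernoulli_mean f (image_mset a (mset_set {1..k})) 0)"
  using k f
proof (induction k arbitrary: f)
  case 0
  interpret prob_space M by fact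
  show ?case by (simp add: S emeasure_space_1)
next
  case (Suc k)
  interpret prob_space M by fact
  have k: "Suc k \<in> {1..n}" using Suc.prems by simp
  have Xk: "X (Suc k) = (\<lambda>\<omega>. S (Suc k) \<omega> - S k \<omega>)" by (simp add: S)
  interpret sigma_finite_subalgebra M "F k"
    by (rule martingale_upto_difference(1)[OF M mart Suc.prems(1)])
  note diff = martingale_upto_difference(2,3)[OF M mart Suc.prems(1), folded Xk]
  have meas: "S k \<in> borel_measurable (F k)" using mart Suc.prems by (simp add: martingale_upto_def)
  have "AE \<omega> in M. nn_cond_exp M (F k) (\<lambda>\<omega>. ennreal ((X (Suc k) \<omega>)\<^sup>2)) \<omega> \<le> ennreal (a (Suc k))"
    using v[OF k]
  proof eventually_elim
    case (elim \<omega>)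
    then have "enn2ereal (nn_cond_exp M (F k) (\<lambda>\<omega>. ennreal ((X (Suc k) \<omega>)\<^sup>2)) \<omega>)
        \<le> enn2ereal (ennreal (a (Suc k)))"
      using a[OF k] by (simp add: cond_variance_def)
    then show ?case by (simp add: less_eq_ennreal.rep_eq)
  qed
  then have "(\<integral>\<^sup>+ \<omega>. ennreal (f (S k \<omega> + X (Suc k) \<omega>)) \<partial>M)
      \<le> (\<integral>\<^sup>+ \<omega>. ennreal (bernoulli_mean (a (Suc k)) f (S k \<omega>)) \<partial>M)"
    by (intro nn_integral_convex_deriv_step diff X k a meas Suc.prems)
  also have "\<dots> \<le> ennreal (fold_mset bernoulli_mean (bernoulli_mean (a (Suc k)) f)
      (image_mset a (mset_set {1..k})) 0)"
    using Suc.prems a[OF k] by (intro Suc.IH convex_deriv_bernoulli_mean) auto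
  finally show ?case
    by (simp add: Xk atLeastAtMostSuc_conv bernoulli_mean.fold_mset_fun_left_comm)
qed

section \<open>The tail bounds\<close>

theorem theorem1p4:
  fixes M :: "'a measure" and F :: "nat \<Rightarrow> 'a measure"
    and X :: "nat \<Rightarrow> 'a \<Rightarrow> real" and S :: "nat \<Rightarrow> 'a \<Rightarrow> real"
    and n :: nat
    and \<sigma>2 \<gamma> \<kappa> :: "nat \<Rightarrow> ereal" and \<alpha> :: "nat \<Rightarrow> real" and s2 :: real
    and N :: "'b measure" and \<epsilon> :: "nat \<Rightarrow> 'b \<Rightarrow> real" and T :: "'b \<Rightarrow> real"
    and x :: real
  assumes "prob_space M"
    and "n \<ge> 1"
    and "\<And>k \<omega>. S k \<omega> = (\<Sum>i=1..k. X i \<omega>)"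
    and "martingale_upto M n F S"
    and "\<And>k. k \<in> {1..n} \<Longrightarrow> AE \<omega> in M. X k \<omega> \<le> 1"
    and "\<And>k. k \<in> {1..n} \<Longrightarrow> AE \<omega> in M. cond_variance M (F (k - 1)) (X k) \<omega> < \<infinity>"
    and "\<And>k. k \<in> {1..n} \<Longrightarrow> AE \<omega> in M. cond_variance M (F (k - 1)) (X k) \<omega> \<le> \<sigma>2 k"
    and "\<And>k. k \<in> {1..n} \<Longrightarrow> AE \<omega> in M. cond_skewness M (F (k - 1)) (X k) \<omega> \<ge> \<gamma> k"
    and "\<And>k. k \<in> {1..n} \<Longrightarrow> AE \<omega> in M. cond_kurtosis M (F (k - 1)) (X k) \<omega> \<le> \<kappa> k"
    and "\<And>k. k \<in> {1..n} \<Longrightarrow> 0 \<le> \<sigma>2 k"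
    and "\<And>k. k \<in> {1..n} \<Longrightarrow> 1 \<le> \<kappa> k"
    and "\<And>k. k \<in> {1..n} \<Longrightarrow>
           ereal ((\<alpha> k)^2) \<ge> Min {\<sigma>2 k, (skew_bound (\<gamma> k))^2, kurt_bound (\<kappa> k)}"
    and "s2 = (\<Sum>k=1..n. (\<alpha> k)^2) / real n"
    and "prob_space N"
    and "prob_space.indep_vars N (\<lambda>_. borel) \<epsilon> {1..n}"
    and "\<And>k. k \<in> {1..n} \<Longrightarrow> bernoulli_var N s2 (\<epsilon> k)"
    and "\<And>\<omega>. T \<omega> = (\<Sum>k=1..n. \<epsilon> k \<omega>)"
  shows "\<P>(\<omega> in M. S n \<omega> \<ge> x) \<le> (INF h\<in>{0<..}. exp (- (h * x)) * (\<integral>\<omega>. exp (h * T \<omega>) \<partial>N))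
       \<and> \<P>(\<omega> in M. S n \<omega> \<ge> x)
           \<le> (INF h\<in>{..<x}. inverse ((x - h)^2) * (\<integral>\<omega>. (max 0 (T \<omega> - h))^2 \<partial>N))"
proof -
  interpret M: prob_space M by fact
  interpret N: prob_space N by fact
  have var: "AE \<omega> in M. cond_variance M (F (k - 1)) (X k) \<omega> \<le> ereal ((\<alpha> k)\<^sup>2)" if k: "k \<in> {1..n}" for k
  proof -
    have k': "Suc (k - 1) \<le> n" "Suc (k - 1) = k" using k by auto
    have Xk: "X k = (\<lambda>\<omega>. S (Suc (k - 1)) \<omega> - S (k - 1) \<omega>)"
      using k' assms(3) by (cases k) auto
    note diff = martingale_upto_difference[OF assms(1,4) k'(1), folded Xk]
    \<comment> \<open>A square is nonnegative, which absorbs the \<open>max 0\<close>.\<close>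
    have le: "max 0 (Min {\<sigma>2 k, (skew_bound (\<gamma> k))\<^sup>2, kurt_bound (\<kappa> k)}) \<le> ereal ((\<alpha> k)\<^sup>2)"
      using assms(12)[OF k] by simp
    show ?thesis
      using cond_variance_le_Min[OF diff assms(5-9,11)[OF k]]
      by eventually_elim (rule order_trans[OF _ le])
  qed
  have s2: "0 \<le> s2" using assms(13) by (simp add: sum_nonneg)
  define A where "A = image_mset (\<lambda>k. (\<alpha> k)\<^sup>2) (mset_set {1..n})"
  have A: "size A = n" "sum_mset A = real n * s2" "\<And>c. c \<in># A \<Longrightarrow> 0 \<le> c"
    using assms(2,13) by (auto simp: A_def sum_unfold_sum_mset)
  have T: "T = (\<lambda>\<omega>. \<Sum>k=1..n. \<epsilon> k \<omega>)" using assms(17) by auto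
  have [measurable]: "T \<in> borel_measurable N"
    unfolding T by (intro borel_measurable_sum) (use assms(16) in \<open>auto simp: bernoulli_var_def\<close>)
  have [measurable]: "S n \<in> borel_measurable M"
    using assms(4) by (auto simp: martingale_upto_def)
  \<comment> \<open>Markov's inequality for a general test function; only growth to the right of
    \<open>x\<close> is required of it, in the form \<open>f x\<close> \<le>
    \<open>f y\<close>.\<close>
  have tail: "M.prob {\<omega> \<in> space M. x \<le> S n \<omega>} * f x \<le> (\<integral>\<omega>. f (T \<omega>) \<partial>N)"
    if f: "convex_deriv f" and mono: "\<And>y. x \<le> y \<Longrightarrow> f x \<le> f y" for f
  proof -
    have [measurable]: "f \<in> borel_measurable borel" by (rule convex_deriv_measurable[OF f])
    have nonneg: "0 \<le> f y" for y using f by (simp add: convex_deriv_def)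
    define b where "b = fold_mset bernoulli_mean f (replicate_mset n s2) 0"
    have ET: "(\<integral>\<^sup>+ \<omega>. ennreal (f (T \<omega>)) \<partial>N) = ennreal b"
      unfolding T b_def by (rule nn_integral_sum_bernoulli_var[OF assms(14-16) s2 order_refl f])
    have "ennreal (M.prob {\<omega> \<in> space M. x \<le> S n \<omega>} * f x)
        = (\<integral>\<^sup>+ \<omega>. ennreal (f x) * indicator {\<omega> \<in> space M. x \<le> S n \<omega>} \<omega> \<partial>M)"
      using nonneg
      by (simp add: nn_integral_cmult_indicator M.emeasure_eq_measure ennreal_mult mult.commute)
    also have "\<dots> \<le> (\<integral>\<^sup>+ \<omega>. ennreal (f (S n \<omega>)) \<partial>M)"
      using mono by (intro nn_integral_mono) (auto simp: indicator_def intro: ennreal_leI)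
    also have "\<dots> \<le> ennreal (fold_mset bernoulli_mean f A 0)"
      unfolding A_def
      by (rule nn_integral_martingale_le[OF assms(1,4,3,5) var _ order_refl f]) auto
    also have "\<dots> \<le> ennreal b"
      using fold_bernoulli_mean_le_replicate[where f = f and A = A and m = s2 and t = 0, OF f A(3)] A(1,2)
      unfolding b_def by (intro ennreal_leI) simp
    finally have le: "ennreal (M.prob {\<omega> \<in> space M. x \<le> S n \<omega>} * f x) \<le> ennreal b" .
    \<comment> \<open>By \<open>ET\<close> the nonnegative integral is finite, so the Bochner
      integral is the true expectation and not the default 0 of a non-integrable function.\<close>
    have "(\<integral>\<omega>. f (T \<omega>) \<partial>N) = enn2real (ennreal b)"
      unfolding ET[symmetric] by (rule integral_eq_nn_integral) (use nonneg in auto)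
    moreover have "M.prob {\<omega> \<in> space M. x \<le> S n \<omega>} * f x \<le> enn2real (ennreal b)"
      using enn2real_mono[OF le] nonneg[of x] by simp
    ultimately show ?thesis by simp
  qed
  show ?thesis
  \<comment> \<open>A lower bound of a nonempty set of reals is at most its infimum, so each
    \<open>h\<close> can be treated separately.\<close>
  proof (intro conjI cINF_greatest)
    fix h :: real assume h: "h \<in> {0<..}"
    have "M.prob {\<omega> \<in> space M. x \<le> S n \<omega>} * exp (h * x) \<le> (\<integral>\<omega>. exp (h * T \<omega>) \<partial>N)"
      using h by (intro tail convex_deriv_exp) auto
    then show "M.prob {\<omega> \<in> space M. x \<le> S n \<omega>} \<le> exp (- (h * x)) * (\<integral>\<omega>. exp (h * T \<omega>) \<partial>N)"
      by (simp add: exp_minus field_simps)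
  next
    fix h :: real assume h: "h \<in> {..<x}"
    have "M.prob {\<omega> \<in> space M. x \<le> S n \<omega>} * (max 0 (x - h))\<^sup>2 \<le> (\<integral>\<omega>. (max 0 (T \<omega> - h))\<^sup>2 \<partial>N)"
      using h by (intro tail convex_deriv_pos_part_square power_mono) auto
    then show "M.prob {\<omega> \<in> space M. x \<le> S n \<omega>} \<le> inverse ((x - h)\<^sup>2) * (\<integral>\<omega>. (max 0 (T \<omega> - h))\<^sup>2 \<partial>N)"
      using h by (simp add: field_simps)
  qed auto
qed

end
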